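(* Let $D: f=0$ be a reduced surface of degree $d$ in $\mathbb{P}^3$ over $\mathbb{C}$, not a cone over a plane curve and with one-dimensional singular subscheme. Suppose $D$ is tame with respect to the pair of syzygies $\rho_1,\rho_2$, of degrees $e_1=\deg\rho_1\le e_2=\deg\rho_2$. Set $e_3=d-1-e_1-e_2$ and assume $e_3\ge e_2$. Then the following hold. (1) For any $k<e_3+d-1$, $$\dim M(f)_k=\binom{k+3}{3}-4\binom{k-d+4}{3}+\sum_{j=1}^{2}\binom{k-d-e_j+4}{3}.$$ In particular, these dimensions are independent of $f$ once the degrees $e_1$ and $e_2$ are fixed (the degree $d$ being given). (2) For any $k\ge e_3+d-1$, $$\dim M(f)_k\le\binom{k+3}{3}-4\binom{k-d+4}{3}+\sum_{j=1}^{3}\binom{k-d-e_j+4}{3},$$ and equality holds for all $k\ge e_3+d-1$ if and only if it holds for $k=e_3+d-1$. Moreover, these equalities hold exactly when $D$ is a free surface with exponents $e_1,e_2,e_3$.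
   Context: Let $S=\mathbb{C}[x,y,z,w]$ with the standard grading, $f\in S$ homogeneous of degree $d$, with partial derivatives $f_x,f_y,f_z,f_w$, Jacobian ideal $J_f=(f_x,f_y,f_z,f_w)$ and Milnor algebra $M(f)=S/J_f$ (graded). The singular subscheme $\Sigma$ of $D:f=0$ is the subscheme of $\mathbb{P}^3$ defined by $J_f$. Syzygies: $AR(f)\subset S^4$ is the graded $S$-module of all $\rho=(\alpha,\beta,\gamma,\delta)$ with $\alpha f_x+\beta f_y+\gamma f_z+\delta f_w=0$; $AR(f)_q$ consists of those with all components in $S_q$, and such a $\rho$ has degree $q$. Choice of $\rho_1,\rho_2$: $\rho_1$ is a nonzero homogeneous element of minimal degree $e_1$ in $AR(f)$, and $\rho_2\in AR(f)$ is a homogeneous representative of a nonzero homogeneous element of minimal degree $e_2\ge e_1$ in $AR(f)/(S\rho_1)$. Tameness: let $\Omega^k$ be the $S$-module of algebraic differential $k$-forms on $\mathbb{C}^4$; for $\rho=(\alpha,\beta,\gamma,\delta)$ put $\omega(\rho)=\alpha\,dx+\beta\,dy+\gamma\,dz+\delta\,dw$, and let $\Omega^1_0=\{\omega(\rho):\rho\in AR(f)\}$. $D$ is tame with respect to $\rho_1,\rho_2$ (where $\rho_1$ is a nonzero element of minimal degree $e_1$ in $AR(f)$ and $\rho_2$ represents a nonzero homogeneous element of minimal degree $e_2$ in $AR(f)/(S\rho_1)$) if the sequence $S(-e_1-1)\oplus S(-e_2-1)\xrightarrow{u}\Omega^1_0\xrightarrow{v}\Omega^3(e_1+e_2+2)$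 is exact (at the middle term), where $u(a,b)=a\,\omega(\rho_1)+b\,\omega(\rho_2)$ and $v(\omega)=\omega(\rho_1)\wedge\omega(\rho_2)\wedge\omega$. Freeness: $D$ is free with exponents $d_1\le d_2\le d_3$ if $AR(f)\cong S(-d_1)\oplus S(-d_2)\oplus S(-d_3)$ as graded $S$-modules (the $d_i$ positive integers). Convention: $\binom{m+3}{3}$ denotes $\dim S_m$; in particular it is $0$ for $m<0$. *)

theory Defs
  imports
    "HOL-Analysis.Analysis"
    "HOL-Library.Poly_Mapping"
    "HOL-Computational_Algebra.Squarefree"
begin

section \<open>The graded polynomial ring in four variables\<close>

text \<open>
  The index type \<open>4\<close> has the elements \<open>1, 2, 3, 4\<close> (with \<open>4 = 0\<close>); they number the coordinates
  \<open>x, y, z, w\<close> in this order. A monomial is an exponent vector \<open>4 \<Rightarrow>\<^sub>0 nat\<close>, and the product of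
  \<open>poly_mapping\<close> is the convolution product, i.e. the product of polynomials.
\<close>

type_synonym monom4 = "4 \<Rightarrow>\<^sub>0 nat"
type_synonym S4 = "monom4 \<Rightarrow>\<^sub>0 complex"

definition Var :: "4 \<Rightarrow> S4" where
  "Var i = Poly_Mapping.single (Poly_Mapping.single i 1) 1"

definition Const :: "complex \<Rightarrow> S4" where
  "Const c = Poly_Mapping.single 0 c"

definition mdeg :: "monom4 \<Rightarrow> nat" where
  "mdeg m = (\<Sum>i\<in>UNIV. Poly_Mapping.lookup m i)"

text \<open>Degrees are integers, so that shifts need no truncated subtraction: \<open>graded q = {0}\<close> for
  \<open>q < 0\<close>.\<close>

definition graded :: "int \<Rightarrow> S4 set" where
  "graded q = {p. \<forall>m\<in>Poly_Mapping.keys p. int (mdeg m) = q}"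

definition pdiff :: "4 \<Rightarrow> S4 \<Rightarrow> S4" where
  "pdiff i p = (\<Sum>m\<in>Poly_Mapping.keys p.
     Poly_Mapping.single (m - Poly_Mapping.single i 1) (of_nat (Poly_Mapping.lookup m i) * Poly_Mapping.lookup p m))"

text \<open>The binomial coefficient \<open>(m+3 choose 3) = dim S_m\<close>, with the convention that it vanishes for
  negative \<open>m\<close>.\<close>

definition binom3 :: "int \<Rightarrow> int" where
  "binom3 m = (if m < 0 then 0 else int ((nat m + 3) choose 3))"

section \<open>Ideals and dimension of projective schemes\<close>

abbreviation ideal_gen :: "S4 set \<Rightarrow> S4 set" where
  "ideal_gen B \<equiv> module.span (*) B"

definition prime_ideal :: "S4 set \<Rightarrow> bool" where
  "prime_ideal P \<longleftrightarrow> module.subspace (*) P \<and> 1 \<notin> P \<and> (\<forall>a b. a * b \<in> P \<longrightarrow> a \<in> P \<or> b \<in> P)"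

definition homogeneous_ideal :: "S4 set \<Rightarrow> bool" where
  "homogeneous_ideal I \<longleftrightarrow> (\<exists>B. (\<forall>p\<in>B. \<exists>q. p \<in> graded q) \<and> I = ideal_gen B)"

text \<open>The points of the closed subscheme \<open>Proj (S/I)\<close> of projective 3-space.\<close>

definition proj_points :: "S4 set \<Rightarrow> S4 set set" where
  "proj_points I = {P. prime_ideal P \<and> homogeneous_ideal P \<and> I \<subseteq> P \<and> \<not> ideal_gen (range Var) \<subseteq> P}"

definition proj_chain :: "S4 set \<Rightarrow> nat \<Rightarrow> bool" where
  "proj_chain I n \<longleftrightarrow> (\<exists>P :: nat \<Rightarrow> S4 set.
     (\<forall>i\<le>n. P i \<in> proj_points I) \<and> (\<forall>i<n. P i \<subset> P (Suc i)))"

text \<open>\<open>Proj (S/I)\<close> has Krull dimension \<open>n\<close>: the irreducible closed subsets of \<open>Proj (S/I)\<close>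
  correspond to its points, with reversed inclusion.\<close>

definition has_proj_dim :: "S4 set \<Rightarrow> nat \<Rightarrow> bool" where
  "has_proj_dim I n \<longleftrightarrow> proj_chain I n \<and> \<not> proj_chain I (Suc n)"

section \<open>Surfaces\<close>

definition reduced_surface :: "int \<Rightarrow> S4 \<Rightarrow> bool" where
  "reduced_surface d f \<longleftrightarrow> d \<ge> 1 \<and> f \<in> graded d \<and> squarefree f"

definition lin_subst :: "complex^4^4 \<Rightarrow> S4 \<Rightarrow> S4" where
  "lin_subst A p = (\<Sum>m\<in>Poly_Mapping.keys p.
     Const (Poly_Mapping.lookup p m) * (\<Prod>i\<in>UNIV. (\<Sum>j\<in>UNIV. Const (A $ i $ j) * Var j) ^ Poly_Mapping.lookup m i))"

text \<open>Cone over a plane curve: in suitable homogeneous coordinates the equation lies in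
  \<open>\<complex>[x,y,z]\<close>, so that the vertex is \<open>(0:0:0:1)\<close>.\<close>

definition cone_over_plane_curve :: "S4 \<Rightarrow> bool" where
  "cone_over_plane_curve f \<longleftrightarrow>
     (\<exists>A. invertible A \<and> (\<forall>m\<in>Poly_Mapping.keys (lin_subst A f). Poly_Mapping.lookup m 4 = 0))"

definition jacobian_ideal :: "S4 \<Rightarrow> S4 set" where
  "jacobian_ideal f = ideal_gen (range (\<lambda>i. pdiff i f))"

section \<open>The Milnor algebra\<close>

text \<open>\<open>B\<close> represents a basis of the image of the complex vector space \<open>V\<close> in \<open>S/W\<close>; linear
  independence modulo \<open>W\<close> makes the classes of the elements of \<open>B\<close> distinct.\<close>

definition basis_modulo :: "S4 set \<Rightarrow> S4 set \<Rightarrow> S4 set \<Rightarrow> bool" where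
  "basis_modulo W V B \<longleftrightarrow> finite B \<and> B \<subseteq> V \<and>
     (\<forall>v\<in>V. \<exists>c. v - (\<Sum>b\<in>B. Const (c b) * b) \<in> W) \<and>
     (\<forall>c. (\<Sum>b\<in>B. Const (c b) * b) \<in> W \<longrightarrow> (\<forall>b\<in>B. c b = 0))"

text \<open>The dimension of the degree \<open>k\<close> part of \<open>M(f) = S/J_f\<close>, i.e. of the image of \<open>S_k\<close>.\<close>

definition milnor_dim :: "S4 \<Rightarrow> int \<Rightarrow> nat" where
  "milnor_dim f k = (THE n. \<exists>B. basis_modulo (jacobian_ideal f) (graded k) B \<and> card B = n)"

section \<open>Syzygies\<close>

definition AR :: "S4 \<Rightarrow> (S4^4) set" where
  "AR f = {\<rho>. (\<Sum>i\<in>UNIV. \<rho> $ i * pdiff i f) = 0}"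

definition AR_graded :: "S4 \<Rightarrow> int \<Rightarrow> (S4^4) set" where
  "AR_graded f q = {\<rho> \<in> AR f. \<forall>i. \<rho> $ i \<in> graded q}"

definition first_syzygy :: "S4 \<Rightarrow> int \<Rightarrow> S4^4 \<Rightarrow> bool" where
  "first_syzygy f e1 \<rho>1 \<longleftrightarrow> \<rho>1 \<in> AR_graded f e1 \<and> \<rho>1 \<noteq> 0 \<and>
     (\<forall>q. \<forall>\<rho>\<in>AR_graded f q. \<rho> \<noteq> 0 \<longrightarrow> e1 \<le> q)"

text \<open>The homogeneous elements of \<open>AR(f)/(S \<rho>1)\<close> are the classes of homogeneous syzygies, and
  such a class is nonzero iff the syzygy is not a multiple of \<open>\<rho>1\<close>.\<close>

definition second_syzygy :: "S4 \<Rightarrow> S4^4 \<Rightarrow> int \<Rightarrow> S4^4 \<Rightarrow> bool" where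
  "second_syzygy f \<rho>1 e2 \<rho>2 \<longleftrightarrow> \<rho>2 \<in> AR_graded f e2 \<and> \<rho>2 \<notin> range (\<lambda>a. a *s \<rho>1) \<and>
     (\<forall>q. \<forall>\<rho>\<in>AR_graded f q. \<rho> \<notin> range (\<lambda>a. a *s \<rho>1) \<longrightarrow> e2 \<le> q)"

section \<open>Differential forms and tameness\<close>

text \<open>
  An algebraic differential form on affine 4-space is given by its coefficients with respect to the
  basis \<open>dx_I = dx_i1 \<and> \<dots> \<and> dx_ik\<close>, where \<open>I = {i1 < \<dots> < ik}\<close> ranges over the sets of indices;
  the \<open>k\<close>-forms are those supported on sets of size \<open>k\<close>. The order used is the library's order on
  the type \<open>4\<close>. The sign is that of \<open>dx_I \<and> dx_J = \<plusminus> dx_(I \<union> J)\<close> for disjoint \<open>I, J\<close>.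
\<close>

type_synonym form4 = "S4^(4 set)"

definition wedge_sign :: "4 set \<Rightarrow> 4 set \<Rightarrow> S4" where
  "wedge_sign I J = (-1) ^ card {(i, j). i \<in> I \<and> j \<in> J \<and> j < i}"

definition wedge :: "form4 \<Rightarrow> form4 \<Rightarrow> form4" (infixl \<open>\<and>\<^sub>f\<close> 70) where
  "\<alpha> \<and>\<^sub>f \<beta> = (\<chi> K. \<Sum>I\<in>Pow K. wedge_sign I (K - I) * \<alpha> $ I * \<beta> $ (K - I))"

definition dcoord :: "4 \<Rightarrow> form4" where
  "dcoord i = (\<chi> K. if K = {i} then 1 else 0)"

definition omega :: "S4^4 \<Rightarrow> form4" where
  "omega \<rho> = (\<Sum>i\<in>UNIV. (\<rho> $ i) *s dcoord i)"

definition Omega10 :: "S4 \<Rightarrow> form4 set" where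
  "Omega10 f = omega ` AR f"

definition u_map :: "S4^4 \<Rightarrow> S4^4 \<Rightarrow> S4 \<times> S4 \<Rightarrow> form4" where
  "u_map \<rho>1 \<rho>2 = (\<lambda>(a, b). a *s omega \<rho>1 + b *s omega \<rho>2)"

definition v_map :: "S4^4 \<Rightarrow> S4^4 \<Rightarrow> form4 \<Rightarrow> form4" where
  "v_map \<rho>1 \<rho>2 \<eta> = omega \<rho>1 \<and>\<^sub>f omega \<rho>2 \<and>\<^sub>f \<eta>"

text \<open>The degree shifts only make \<open>u\<close> and \<open>v\<close> homogeneous of degree 0; exactness is a statement
  about the underlying modules.\<close>

definition tame :: "S4 \<Rightarrow> int \<Rightarrow> S4^4 \<Rightarrow> int \<Rightarrow> S4^4 \<Rightarrow> bool" where
  "tame f e1 \<rho>1 e2 \<rho>2 \<longleftrightarrow> first_syzygy f e1 \<rho>1 \<and> second_syzygy f \<rho>1 e2 \<rho>2 \<and>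
     range (u_map \<rho>1 \<rho>2) = {\<eta> \<in> Omega10 f. v_map \<rho>1 \<rho>2 \<eta> = 0}"

section \<open>Freeness\<close>

text \<open>A graded isomorphism from \<open>S(-d1) \<oplus> S(-d2) \<oplus> S(-d3)\<close> onto \<open>AR(f)\<close>; recall
  \<open>S(-d)_q = S_(q-d)\<close>.\<close>

definition free_with_exponents :: "S4 \<Rightarrow> int \<Rightarrow> int \<Rightarrow> int \<Rightarrow> bool" where
  "free_with_exponents f d1 d2 d3 \<longleftrightarrow> 0 < d1 \<and> d1 \<le> d2 \<and> d2 \<le> d3 \<and>
     (\<exists>\<phi> :: S4^3 \<Rightarrow> S4^4. module_hom (*s) (*s) \<phi> \<and> bij_betw \<phi> UNIV (AR f) \<and>
        (\<forall>q s. s $ 1 \<in> graded (q - d1) \<and> s $ 2 \<in> graded (q - d2) \<and> s $ 3 \<in> graded (q - d3)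
           \<longrightarrow> \<phi> s \<in> AR_graded f q))"

end

theory Submission
  imports
    Defs
    "HOL-Computational_Algebra.Field_as_Ring"
    "HOL-Computational_Algebra.Polynomial_Factorial"
begin

text \<open>
  Rank-nullity for the map \<open>S\<^sub>q\<^sup>4 \<rightarrow> S\<^sub>k\<close>, \<open>a \<mapsto> \<Sum> a\<^sub>i f\<^sub>i\<close>, with \<open>q = k - d + 1\<close>, gives
  \<open>dim M(f)\<^sub>k = dim S\<^sub>k - 4 dim S\<^sub>q + dim AR(f)\<^sub>q\<close>, so it suffices to bound \<open>dim AR(f)\<^sub>q\<close>. The
  coefficient vector of \<open>\<omega>(\<rho>1) \<and> \<omega>(\<rho>2) \<and> \<omega>(\<rho>)\<close> is orthogonal to the three syzygies, as is the
  gradient of \<open>f\<close>, hence the two are proportional. Since \<open>f\<close> is squarefree, Euler's identity and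
  unique factorization show that the partial derivatives have no common factor, so the vector is
  \<open>g \<cdot> grad f\<close> with a polynomial \<open>g\<close> of degree \<open>q - e3\<close>. By tameness the kernel of \<open>\<rho> \<mapsto> g\<close> is
  \<open>S \<rho>1 + S \<rho>2\<close>, and this sum is direct because \<open>AR(f)\<close> does not have rank one. Hence \<open>dim AR(f)\<^sub>q\<close>
  is \<open>dim S_(q - e1) + dim S_(q - e2)\<close> plus the dimension of a subspace of \<open>S_(q - e3)\<close>. For \<open>q = e3\<close> the
  latter is maximal iff \<open>g = 1\<close> is attained at some \<open>\<rho>3\<close>, that is, iff \<open>\<rho>1, \<rho>2, \<rho>3\<close> is a basis of
  \<open>AR(f)\<close>.
\<close>

section \<open>Dimensions of finite-dimensional subspaces\<close>

context vector_space
begin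

text \<open>The dimension function \<open>dim\<close> also returns 0 when a basis is infinite, so
  finiteness has to be tracked separately before dimensions can be compared.\<close>

definition findim :: "'b set \<Rightarrow> bool" where
  "findim V \<longleftrightarrow> (\<exists>F. finite F \<and> V \<subseteq> span F)"

lemma findim_subset: "local.findim V \<Longrightarrow> U \<subseteq> V \<Longrightarrow> local.findim U"
  unfolding local.findim_def by blast

lemma findim_span: "finite F \<Longrightarrow> local.findim (span F)"
  unfolding local.findim_def by blast

lemma findim_independent_finite: "local.findim V \<Longrightarrow> B \<subseteq> V \<Longrightarrow> independent B \<Longrightarrow> finite B"
  unfolding local.findim_def using independent_span_bound by blast

lemma findim_dim_mono:
  assumes "local.findim V" "U \<subseteq> V"
  shows "dim U \<le> dim V"
proof -
  obtain B where B: "B \<subseteq> U" "independent B" "U \<subseteq> span B" "card B = dim U"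
    using basis_exists .
  obtain C where C: "B \<subseteq> C" "C \<subseteq> V" "independent C" "V \<subseteq> span C"
    using maximal_independent_subset_extend[of B V] B assms by blast
  have "finite C" using local.findim_independent_finite assms C by blast
  then have "card B \<le> card C" using C card_mono by blast
  then show ?thesis using B C basis_card_eq_dim[of C V] by simp
qed

lemma findim_dim_eq:
  assumes "local.findim V" "U \<subseteq> V" "subspace U" "dim U = dim V"
  shows "U = V"
proof -
  obtain B where B: "B \<subseteq> U" "independent B" "U \<subseteq> span B" "card B = dim U"
    using basis_exists .
  obtain C where C: "B \<subseteq> C" "C \<subseteq> V" "independent C" "V \<subseteq> span C"
    using maximal_independent_subset_extend[of B V] B assms by blast
  have "finite C" using local.findim_independent_finite assms C by blast
  moreover have "card B = card C" using B C basis_card_eq_dim[of C V] assms by simp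
  ultimately have "B = C" using C card_subset_eq by blast
  then show ?thesis using B C assms span_minimal by blast
qed

text \<open>The coordinates of \<open>x\<close> with respect to \<open>C\<close> agree with those
  with respect to \<open>A\<close> and to \<open>B\<close>, so their support lies in the empty set
  \<open>A \<inter> B\<close>.\<close>

lemma span_Int_disjoint:
  assumes "independent C" "A \<subseteq> C" "B \<subseteq> C" "A \<inter> B = {}" "x \<in> span A" "x \<in> span B"
  shows "x = 0"
proof -
  have "representation C x = representation A x" "representation C x = representation B x"
    using representation_extend[of C x A] representation_extend[of C x B] assms by auto
  then have z: "representation C x b = 0" for b
    using representation_ne_zero[of A x b] representation_ne_zero[of B x b] assms(4) by auto
  have "x \<in> span C" using assms span_mono by blast
  then have "x = (\<Sum>b | representation C x b \<noteq> 0. scale (representation C x b) b)"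
    using sum_nonzero_representation_eq assms(1) by metis
  then show ?thesis using z by simp
qed

end

text \<open>A new locale, because facts added to \<open>linear\<close> itself would be hidden by their instances for
  real vector spaces. For the same reason names are prefixed with \<open>local\<close> above.\<close>

locale linear_map = Vector_Spaces.linear s1 s2 f
  for s1 :: "'a::field \<Rightarrow> 'b::ab_group_add \<Rightarrow> 'b" and s2 :: "'a \<Rightarrow> 'c::ab_group_add \<Rightarrow> 'c" and f
begin

text \<open>A basis \<open>B\<close> of the kernel is extended to a basis \<open>C\<close> of
  \<open>U\<close>. The span of the added vectors meets the kernel only in 0, so \<open>f\<close> is
  injective there and carries \<open>C - B\<close> to a basis of the image.\<close>

lemma rank_nullity_basis:
  assumes U: "vs1.subspace U"
  obtains B C where "B \<subseteq> C" "C \<subseteq> U" "vs1.independent C" "U \<subseteq> vs1.span C"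
    "vs1.independent B" "B \<subseteq> {u \<in> U. f u = 0}" "{u \<in> U. f u = 0} \<subseteq> vs1.span B"
    "inj_on f (C - B)" "vs2.independent (f ` (C - B))" "f ` U \<subseteq> vs2.span (f ` (C - B))"
proof -
  let ?N = "{u \<in> U. f u = 0}"
  obtain B where B: "B \<subseteq> ?N" "vs1.independent B" "?N \<subseteq> vs1.span B" "card B = vs1.dim ?N"
    using vs1.basis_exists[of ?N] .
  obtain C where C: "B \<subseteq> C" "C \<subseteq> U" "vs1.independent C" "U \<subseteq> vs1.span C"
    using vs1.maximal_independent_subset_extend[of B U] B by blast
  have inj: "inj_on f (vs1.span (C - B))"
  proof (subst inj_on_iff_eq_0)
    show "vs1.subspace (vs1.span (C - B))" by simp
    show "\<forall>x\<in>vs1.span (C - B). f x = 0 \<longrightarrow> x = 0"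
    proof (intro ballI impI)
      fix x assume x: "x \<in> vs1.span (C - B)" "f x = 0"
      have "vs1.span (C - B) \<subseteq> U" using C U vs1.span_minimal[of "C - B" U] by blast
      then have "x \<in> vs1.span B" using x B by blast
      then show "x = 0"
        using vs1.span_Int_disjoint[of C B "C - B" x] x C by blast
    qed
  qed
  have "vs1.independent (C - B)" using C vs1.independent_mono by blast
  then have ind: "vs2.independent (f ` (C - B))"
    using inj independent_injective_image by blast
  have injC: "inj_on f (C - B)"
    using inj vs1.span_superset inj_on_subset by blast
  have "f ` U \<subseteq> vs2.span (f ` C)" using C spans_image by blast
  also have "\<dots> \<subseteq> vs2.span (f ` (C - B))"
  proof (rule vs2.span_minimal)
    show "f ` C \<subseteq> vs2.span (f ` (C - B))"
    proof
      fix y assume "y \<in> f ` C"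
      then obtain c where c: "c \<in> C" "y = f c" by blast
      then show "y \<in> vs2.span (f ` (C - B))"
        using B vs2.span_zero vs2.span_base by (cases "c \<in> B") auto
    qed
  qed simp
  finally show ?thesis using that[OF C B(2,1,3) injC ind] by metis
qed

text \<open>Finiteness of \<open>B\<close> and of the image of \<open>C - B\<close> makes
  \<open>C\<close> finite; counting \<open>C\<close> as \<open>B\<close> plus \<open>C - B\<close>
  gives rank-nullity.\<close>

lemma
  assumes U: "vs1.subspace U" and fd: "vs1.findim {u \<in> U. f u = 0}" "vs2.findim (f ` U)"
  shows findim_rank_nullity: "vs1.findim U"
    and dim_rank_nullity: "vs1.dim U = vs1.dim {u \<in> U. f u = 0} + vs2.dim (f ` U)"
proof -
  obtain B C where BC: "B \<subseteq> C" "C \<subseteq> U" "vs1.independent C" "U \<subseteq> vs1.span C"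
    "vs1.independent B" "B \<subseteq> {u \<in> U. f u = 0}" "{u \<in> U. f u = 0} \<subseteq> vs1.span B"
    "inj_on f (C - B)" "vs2.independent (f ` (C - B))" "f ` U \<subseteq> vs2.span (f ` (C - B))"
    using rank_nullity_basis[OF U] .
  have "finite B" by (rule vs1.findim_independent_finite[OF fd(1) BC(6,5)])
  moreover have "f ` (C - B) \<subseteq> f ` U" using BC by blast
  then have "finite (f ` (C - B))" by (rule vs2.findim_independent_finite[OF fd(2) _ BC(9)])
  then have "finite (C - B)" using BC finite_imageD by blast
  ultimately have fC: "finite C" by simp
  then show "vs1.findim U" using BC unfolding vs1.findim_def by blast
  have "card C = card B + card (C - B)"
    using fC BC by (simp add: card_Diff_subset card_mono finite_subset)
  moreover have "card (C - B) = card (f ` (C - B))" using BC(8) by (simp add: card_image)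
  moreover have "card C = vs1.dim U" "card B = vs1.dim {u \<in> U. f u = 0}"
    using BC vs1.basis_card_eq_dim[of C U] vs1.basis_card_eq_dim[of B "{u \<in> U. f u = 0}"] by auto
  moreover have "card (f ` (C - B)) = vs2.dim (f ` U)"
    using BC \<open>f ` (C - B) \<subseteq> f ` U\<close> vs2.basis_card_eq_dim[of "f ` (C - B)" "f ` U"] by auto
  ultimately show "vs1.dim U = vs1.dim {u \<in> U. f u = 0} + vs2.dim (f ` U)" by linarith
qed

lemma findim_image: "vs1.findim U \<Longrightarrow> vs2.findim (f ` U)"
  unfolding vs1.findim_def vs2.findim_def by (meson finite_imageI spans_image)

lemma dim_injective_image:
  assumes "vs1.subspace U" "vs1.findim U" "\<And>u. u \<in> U \<Longrightarrow> f u = 0 \<Longrightarrow> u = 0"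
  shows "vs2.dim (f ` U) = vs1.dim U"
proof -
  have N: "{u \<in> U. f u = 0} = {0}" using assms vs1.subspace_0 by auto
  have "vs1.dim {0} = 0"
    using vs1.dim_unique[of "{}" "{0}" 0] vs1.independent_empty by simp
  moreover have "vs1.findim {0}"
    using vs1.findim_subset[OF assms(2), of "{0}"] vs1.subspace_0[OF assms(1)] by simp
  ultimately show ?thesis
    using dim_rank_nullity[OF assms(1), unfolded N] findim_image[OF assms(2)] by simp
qed

end

section \<open>The graded polynomial ring\<close>

lemma lookup_single_if: "Poly_Mapping.lookup (Poly_Mapping.single k v) k' = (if k = k' then v else 0)"
  by (simp add: lookup_single when_def)

lemma poly_mapping_sum_single:
  "p = (\<Sum>m\<in>Poly_Mapping.keys p. Poly_Mapping.single m (Poly_Mapping.lookup p m))"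
  by (rule poly_mapping_eqI) (simp add: lookup_sum lookup_single_if in_keys_iff)

text \<open>Identities that are additive in a polynomial need to be checked on monomials
  only.\<close>

lemma poly_mapping_single_induct [case_names single add]:
  fixes p :: "'a \<Rightarrow>\<^sub>0 'b::comm_monoid_add"
  assumes "\<And>m c. P (Poly_Mapping.single m c)" and "\<And>p q. P p \<Longrightarrow> P q \<Longrightarrow> P (p + q)"
  shows "P p"
proof -
  have P0: "P 0" using assms(1)[of _ 0] by simp
  have "P (\<Sum>m\<in>A. Poly_Mapping.single m (Poly_Mapping.lookup p m))"
    if "finite A" for A
    using that by (induction A rule: finite_induct) (simp_all add: assms P0)
  then show ?thesis using poly_mapping_sum_single[of p] finite_keys[of p] by metis
qed

text \<open>Subtraction of exponents is truncated, so the condition asks first whether the monomial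
  \<open>s\<close> divides the monomial \<open>m\<close>.\<close>

lemma lookup_single_mult:
  fixes p :: S4
  shows "Poly_Mapping.lookup (Poly_Mapping.single s c * p) m =
    (if \<forall>i. Poly_Mapping.lookup s i \<le> Poly_Mapping.lookup m i then c * Poly_Mapping.lookup p (m - s) else 0)"
proof (induction p rule: poly_mapping_single_induct)
  case (single n b)
  have "s + n = m \<longleftrightarrow> (\<forall>i. Poly_Mapping.lookup s i \<le> Poly_Mapping.lookup m i) \<and> n = m - s"
    unfolding poly_mapping_eq_iff fun_eq_iff lookup_add lookup_minus by (metis add_diff_cancel_left' le_add1 le_add_diff_inverse)
  then show ?case by (auto simp: mult_single lookup_single_if)
next
  case (add p q)
  then show ?case by (auto simp: lookup_add distrib_left)
qed

lemma Const_add: "Const (a + b) = Const a + Const b"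
  and Const_mult: "Const (a * b) = Const a * Const b"
  and Const_0 [simp]: "Const 0 = 0"
  and Const_1 [simp]: "Const 1 = 1"
  by (simp_all add: Const_def single_add mult_single)

lemma lookup_Const_mult [simp]: "Poly_Mapping.lookup (Const c * p) m = c * Poly_Mapping.lookup p m"
  by (simp add: Const_def lookup_single_mult)

lemma lookup_Const: "Poly_Mapping.lookup (Const c) m = (if m = 0 then c else 0)"
  by (auto simp add: Const_def lookup_single_if)

lemma Const_eq_iff: "Const c = Const d \<longleftrightarrow> c = d"
  by (metis lookup_Const)

lemma lookup_Var_mult:
  "Poly_Mapping.lookup (Var i * p) m =
    (if Poly_Mapping.lookup m i = 0 then 0 else Poly_Mapping.lookup p (m - Poly_Mapping.single i 1))"
proof -
  have "(\<forall>j. Poly_Mapping.lookup (Poly_Mapping.single i (1::nat)) j \<le> Poly_Mapping.lookup m j)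
    \<longleftrightarrow> Poly_Mapping.lookup m i \<noteq> 0"
    by (auto simp: lookup_single_if Suc_le_eq)
  then show ?thesis by (simp add: Var_def lookup_single_mult)
qed

section \<open>Complex vector space structures on polynomials and on vectors of polynomials\<close>

abbreviation cscale :: "complex \<Rightarrow> S4 \<Rightarrow> S4" where
  "cscale c p \<equiv> Const c * p"

abbreviation vscale :: "complex \<Rightarrow> S4^'n \<Rightarrow> S4^'n" where
  "vscale c v \<equiv> Const c *s v"

interpretation CS: vector_space cscale
  by unfold_locales (simp_all add: Const_add Const_mult algebra_simps)

interpretation CV: vector_space "vscale :: complex \<Rightarrow> S4^'n \<Rightarrow> S4^'n"
  by unfold_locales (simp_all add: Const_add Const_mult algebra_simps vec_eq_iff)

section \<open>Degrees and homogeneous polynomials\<close>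

lemma mdeg_add: "mdeg (m + n) = mdeg m + mdeg n"
  by (simp add: mdeg_def lookup_add sum.distrib)

lemma mdeg_single [simp]: "mdeg (Poly_Mapping.single i k) = k"
  by (simp add: mdeg_def lookup_single_if)

lemma graded_iff: "p \<in> graded q \<longleftrightarrow> (\<forall>m. Poly_Mapping.lookup p m \<noteq> 0 \<longrightarrow> int (mdeg m) = q)"
  by (auto simp: graded_def in_keys_iff)

lemma graded_0 [simp]: "0 \<in> graded q"
  by (simp add: graded_iff)

lemma graded_add: "a \<in> graded q \<Longrightarrow> b \<in> graded q \<Longrightarrow> a + b \<in> graded q"
  by (metis (mono_tags, lifting) graded_iff lookup_add add.right_neutral)

lemma graded_uminus: "a \<in> graded q \<Longrightarrow> - a \<in> graded q"
  by (simp add: graded_iff)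

lemma graded_diff: "a \<in> graded q \<Longrightarrow> b \<in> graded q \<Longrightarrow> a - b \<in> graded q"
  using graded_add[of a q "- b"] graded_uminus[of b q] by simp

lemma graded_sum: "(\<And>i. i \<in> I \<Longrightarrow> f i \<in> graded q) \<Longrightarrow> sum f I \<in> graded q"
  by (induction I rule: infinite_finite_induct) (auto intro: graded_add)

lemma graded_mult: "a \<in> graded p \<Longrightarrow> b \<in> graded q \<Longrightarrow> a * b \<in> graded (p + q)"
  unfolding graded_def using keys_mult[of a b] by (fastforce simp: mdeg_add)

lemma graded_Const [simp]: "Const c \<in> graded 0"
  by (auto simp: graded_iff lookup_Const mdeg_def)

lemma graded_zero_iff: "p \<in> graded 0 \<longleftrightarrow> (\<exists>c. p = Const c)"
proof
  assume p: "p \<in> graded 0"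
  have "m = 0" if "mdeg m = 0" for m
    using that by (auto simp: mdeg_def poly_mapping_eq_iff fun_eq_iff)
  then have "p = Const (Poly_Mapping.lookup p 0)"
    using p by (intro poly_mapping_eqI) (auto simp: lookup_Const graded_iff)
  then show "\<exists>c. p = Const c" ..
qed auto

lemma graded_neg: "q < 0 \<Longrightarrow> graded q = {0}"
  by (auto simp: graded_iff poly_mapping_eq_iff fun_eq_iff)

lemma graded_nonneg: "p \<in> graded q \<Longrightarrow> p \<noteq> 0 \<Longrightarrow> q \<ge> 0"
  using graded_neg[of q] by force

lemma subspace_graded: "CS.subspace (graded q)"
  using graded_mult[OF graded_Const, of _ q] by (auto simp: CS.subspace_def graded_add)

text \<open>The projection onto the homogeneous component of degree \<open>q\<close>, used to
  replace arbitrary coefficients of a homogeneous element by homogeneous ones.\<close>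

definition hcomp :: "int \<Rightarrow> S4 \<Rightarrow> S4" where
  "hcomp q p = (\<Sum>m\<in>{m \<in> Poly_Mapping.keys p. int (mdeg m) = q}. Poly_Mapping.single m (Poly_Mapping.lookup p m))"

lemma lookup_hcomp: "Poly_Mapping.lookup (hcomp q p) m = (if int (mdeg m) = q then Poly_Mapping.lookup p m else 0)"
  by (simp add: hcomp_def lookup_sum lookup_single_if in_keys_iff)

lemma hcomp_add: "hcomp q (a + b) = hcomp q a + hcomp q b"
  by (rule poly_mapping_eqI) (simp add: lookup_hcomp lookup_add)

lemma hcomp_0 [simp]: "hcomp q 0 = 0"
  by (rule poly_mapping_eqI) (simp add: lookup_hcomp)

lemma hcomp_sum: "hcomp q (sum f I) = (\<Sum>i\<in>I. hcomp q (f i))"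
  by (induction I rule: infinite_finite_induct) (simp_all add: hcomp_add)

lemma hcomp_graded [simp]: "hcomp q p \<in> graded q"
  by (auto simp: graded_iff lookup_hcomp)

lemma hcomp_of_graded: "p \<in> graded r \<Longrightarrow> hcomp q p = (if q = r then p else 0)"
  by (rule poly_mapping_eqI) (auto simp: graded_iff lookup_hcomp)

text \<open>Multiplication by a form of degree \<open>r\<close> shifts the grading by
  \<open>r\<close>; by additivity it suffices to take a monomial for \<open>a\<close>.\<close>

lemma hcomp_mult: 
  assumes "b \<in> graded r"
  shows "hcomp q (a * b) = hcomp (q - r) a * b"
proof (induction a rule: poly_mapping_single_induct)
  case (single m c)
  have s: "Poly_Mapping.single m c \<in> graded (int (mdeg m))"
    by (auto simp: graded_iff lookup_single_if split: if_splits)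
  show ?case
    using hcomp_of_graded[OF graded_mult[OF s assms], of q] hcomp_of_graded[OF s, of "q - r"] by auto
next
  case (add p q)
  then show ?case by (simp add: hcomp_add distrib_right)
qed

text \<open>Taking components shows that \<open>hcomp p a * b = a * b\<close>, and \<open>b\<close>
  can be cancelled in the integral domain \<open>S4\<close>.\<close>

lemma graded_mult_cancel:
  assumes "a * b \<in> graded (p + q)" "b \<in> graded q" "b \<noteq> 0"
  shows "a \<in> graded p"
proof -
  have "hcomp p a * b = a * b"
    using hcomp_mult[OF assms(2), of "p + q" a] hcomp_of_graded[OF assms(1), of "p + q"]
    by (metis add_diff_cancel_right')
  then have "hcomp p a = a" using assms(3) mult_right_cancel by blast
  then show ?thesis using hcomp_graded by metis
qed

text \<open>Exponent vectors of degree \<open>k\<close> correspond to lists of four naturals with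
  sum \<open>k\<close>, which are counted by stars and bars.\<close>

lemma card_monomials: "finite {m::monom4. mdeg m = k}" "card {m::monom4. mdeg m = k} = (k + 3) choose 3"
proof -
  let ?L = "{l::nat list. length l = 4 \<and> sum_list l = k}"
  let ?h = "\<lambda>m::monom4. [Poly_Mapping.lookup m 1, Poly_Mapping.lookup m 2, Poly_Mapping.lookup m 3, Poly_Mapping.lookup m 4]"
  have inj: "inj_on ?h {m. mdeg m = k}"
    by (auto simp: inj_on_def poly_mapping_eq_iff fun_eq_iff forall_4)
  have "?h ` {m. mdeg m = k} = ?L"
  proof
    show "?h ` {m. mdeg m = k} \<subseteq> ?L" by (auto simp: mdeg_def sum_4)
    show "?L \<subseteq> ?h ` {m. mdeg m = k}"
    proof
      fix l assume l: "l \<in> ?L"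
      then obtain a b c d where abcd: "l = [a,b,c,d]"
        by (auto simp: numeral_eq_Suc length_Suc_conv)
      define m :: monom4 where "m = Abs_poly_mapping (\<lambda>i. if i = 1 then a else if i = 2 then b else if i = 3 then c else d)"
      have "Poly_Mapping.lookup m = (\<lambda>i. if i = 1 then a else if i = 2 then b else if i = 3 then c else d)"
        unfolding m_def by (rule lookup_Abs_poly_mapping) simp
      then have "?h m = l" "mdeg m = k" using l abcd by (auto simp: mdeg_def sum_4)
      then show "l \<in> ?h ` {m. mdeg m = k}" by blast
    qed
  qed
  then have b: "bij_betw ?h {m. mdeg m = k} ?L" using inj by (simp add: bij_betw_def)
  have "finite ?L"
  proof (rule finite_subset)
    show "?L \<subseteq> {l. set l \<subseteq> {..k} \<and> length l = 4}" using member_le_sum_list by fastforce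
  qed (simp add: finite_lists_length_eq)
  then show "finite {m::monom4. mdeg m = k}" using b bij_betw_finite by blast
  have "card {m::monom4. mdeg m = k} = (k + 3) choose k"
    using bij_betw_same_card[OF b] card_length_sum_list[of 4 k] by (simp add: add.commute)
  then show "card {m::monom4. mdeg m = k} = (k + 3) choose 3"
    using binomial_symmetric[of k "k + 3"] by simp
qed

text \<open>The monomials of degree \<open>q\<close> form a basis; for negative \<open>q\<close>
  there are none, in accordance with \<open>binom3\<close>.\<close>

lemma findim_graded: "CS.findim (graded q)"
  and dim_graded: "int (CS.dim (graded q)) = binom3 q"
proof -
  let ?M = "{m. int (mdeg m) = q}"
  let ?B = "(\<lambda>m. Poly_Mapping.single m (1::complex)) ` ?M"
  have M: "finite ?M" "int (card ?M) = binom3 q"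
  proof -
    show "finite ?M"
    proof (cases "q < 0")
      case False
      then have "?M = {m. mdeg m = nat q}" by auto
      then show ?thesis using card_monomials(1) by simp
    qed simp
    show "int (card ?M) = binom3 q"
    proof (cases "q < 0")
      case False
      then have "?M = {m. mdeg m = nat q}" by auto
      then show ?thesis using card_monomials(2)[of "nat q"] False by (simp add: binom3_def)
    qed (simp add: binom3_def)
  qed
  have sub: "?B \<subseteq> graded q" by (auto simp: graded_iff lookup_single_if split: if_splits)
  have span: "graded q \<subseteq> CS.span ?B"
  proof
    fix p assume p: "p \<in> graded q"
    have "(\<Sum>m\<in>Poly_Mapping.keys p. cscale (Poly_Mapping.lookup p m) (Poly_Mapping.single m 1)) \<in> CS.span ?B"
      using p by (intro CS.span_sum CS.span_scale CS.span_base) (auto simp: graded_def)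
    moreover have "cscale c (Poly_Mapping.single m 1) = Poly_Mapping.single m c" for c m
      by (simp add: Const_def mult_single)
    ultimately show "p \<in> CS.span ?B" using poly_mapping_sum_single[of p] by simp
  qed
  have inj: "inj_on (\<lambda>m. Poly_Mapping.single m (1::complex)) ?M"
  proof (rule inj_onI)
    fix m n :: monom4
    assume "Poly_Mapping.single m (1::complex) = Poly_Mapping.single n 1"
    then have "Poly_Mapping.lookup (Poly_Mapping.single m (1::complex)) m = Poly_Mapping.lookup (Poly_Mapping.single n 1) m"
      by simp
    then show "m = n" by (auto simp: lookup_single_if split: if_splits)
  qed
  have ind: "CS.independent ?B"
  proof (rule CS.independent_if_scalars_zero)
    show "finite ?B" using M by simp
    fix f x assume s: "(\<Sum>x\<in>?B. cscale (f x) x) = 0" and "x \<in> ?B"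
    then obtain m where m: "m \<in> ?M" "x = Poly_Mapping.single m 1" by blast
    have "0 = Poly_Mapping.lookup (\<Sum>x\<in>?B. cscale (f x) x) m" using s by simp
    also have "\<dots> = Poly_Mapping.lookup (\<Sum>n\<in>?M. cscale (f (Poly_Mapping.single n 1)) (Poly_Mapping.single n 1)) m"
      by (subst sum.reindex[OF inj]) simp
    also have "\<dots> = (\<Sum>n\<in>?M. if n = m then f (Poly_Mapping.single n 1) else 0)"
      by (auto simp: lookup_sum lookup_single_if intro!: sum.cong)
    also have "\<dots> = f x" using m M by simp
    finally show "f x = 0" by simp
  qed
  show "CS.findim (graded q)" unfolding CS.findim_def using M span by blast
  have "card ?B = CS.dim (graded q)" using sub span ind by (rule CS.basis_card_eq_dim)
  then show "int (CS.dim (graded q)) = binom3 q" using M card_image[OF inj] by simp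
qed

section \<open>Partial derivatives\<close>

lemma lookup_pdiff:
  "Poly_Mapping.lookup (pdiff i p) m = of_nat (Suc (Poly_Mapping.lookup m i)) * Poly_Mapping.lookup p (m + Poly_Mapping.single i 1)"
proof -
  \<comment> \<open>Truncation is harmless: if the exponent of \<open>i\<close> in \<open>n\<close>
    is 0, the subtraction leaves \<open>n\<close> unchanged, but the factor in front
    vanishes.\<close>
  have e: "of_nat (Poly_Mapping.lookup n i) * Poly_Mapping.lookup p n * (if n - Poly_Mapping.single i 1 = m then 1 else 0)
     = (if n = m + Poly_Mapping.single i 1 then of_nat (Suc (Poly_Mapping.lookup m i)) * Poly_Mapping.lookup p n else 0)" for n
  proof (cases "Poly_Mapping.lookup n i = 0")
    case True
    then have "n \<noteq> m + Poly_Mapping.single i 1" by (auto simp: lookup_add)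
    then show ?thesis using True by simp
  next
    case False
    then have "n - Poly_Mapping.single i 1 = m \<longleftrightarrow> n = m + Poly_Mapping.single i 1"
      by (auto simp: poly_mapping_eq_iff fun_eq_iff lookup_add lookup_minus lookup_single_if)
    then show ?thesis by (auto simp: lookup_add)
  qed
  have "Poly_Mapping.lookup (pdiff i p) m =
    (\<Sum>n\<in>Poly_Mapping.keys p. of_nat (Poly_Mapping.lookup n i) * Poly_Mapping.lookup p n * (if n - Poly_Mapping.single i 1 = m then 1 else 0))"
    unfolding pdiff_def by (auto simp: lookup_sum lookup_single_if intro!: sum.cong)
  also have "\<dots> = of_nat (Suc (Poly_Mapping.lookup m i)) * Poly_Mapping.lookup p (m + Poly_Mapping.single i 1)"
    unfolding e by (simp add: in_keys_iff)
  finally show ?thesis .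
qed

lemma pdiff_add: "pdiff i (p + q) = pdiff i p + pdiff i q"
  by (rule poly_mapping_eqI) (simp add: lookup_pdiff lookup_add distrib_left)

lemma pdiff_0 [simp]: "pdiff i 0 = 0"
  by (rule poly_mapping_eqI) (simp add: lookup_pdiff)

lemma pdiff_sum: "pdiff i (sum f I) = (\<Sum>j\<in>I. pdiff i (f j))"
  by (induction I rule: infinite_finite_induct) (simp_all add: pdiff_add)

lemma pdiff_single:
  "pdiff i (Poly_Mapping.single m c) =
    Poly_Mapping.single (m - Poly_Mapping.single i 1) (of_nat (Poly_Mapping.lookup m i) * c)"
  by (cases "c = 0") (simp_all add: pdiff_def)

lemma pdiff_mult: "pdiff i (p * q) = pdiff i p * q + p * pdiff i q"
proof (induction p rule: poly_mapping_single_induct)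
  case (single m a)
  show ?case
  proof (induction q rule: poly_mapping_single_induct)
    case (single n b)
    let ?e = "Poly_Mapping.single i (1::nat)"
    \<comment> \<open>When the exponent of \<open>i\<close> in \<open>m\<close> is 0 the two
      truncated exponents may differ, but then both coefficients are 0.\<close>
    have "Poly_Mapping.single (m + n - ?e) (of_nat (Poly_Mapping.lookup m i) * (a * b)) =
      Poly_Mapping.single (m - ?e + n) (of_nat (Poly_Mapping.lookup m i) * (a * b))"
    proof (cases "Poly_Mapping.lookup m i = 0")
      case False
      then have "m + n - ?e = m - ?e + n"
        by (auto simp: poly_mapping_eq_iff fun_eq_iff lookup_add lookup_minus lookup_single_if)
      then show ?thesis by simp
    qed simp
    moreover have "Poly_Mapping.single (m + n - ?e) (of_nat (Poly_Mapping.lookup n i) * (a * b)) =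
      Poly_Mapping.single (m + (n - ?e)) (of_nat (Poly_Mapping.lookup n i) * (a * b))"
    proof (cases "Poly_Mapping.lookup n i = 0")
      case False
      then have "m + n - ?e = m + (n - ?e)"
        by (auto simp: poly_mapping_eq_iff fun_eq_iff lookup_add lookup_minus lookup_single_if)
      then show ?thesis by simp
    qed simp
    ultimately show ?case
      by (simp add: mult_single pdiff_single lookup_add single_add distrib_right mult.assoc
          mult.left_commute[of _ a] distrib_left)
  qed (simp add: pdiff_add distrib_left algebra_simps)
qed (simp add: pdiff_add algebra_simps)

lemma pdiff_graded: "p \<in> graded q \<Longrightarrow> pdiff i p \<in> graded (q - 1)"
  unfolding graded_iff lookup_pdiff
proof (intro allI impI)
  fix m assume *: "\<forall>m. Poly_Mapping.lookup p m \<noteq> 0 \<longrightarrow> int (mdeg m) = q"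
    and "of_nat (Suc (Poly_Mapping.lookup m i)) * Poly_Mapping.lookup p (m + Poly_Mapping.single i 1) \<noteq> 0"
  then have "int (mdeg (m + Poly_Mapping.single i 1)) = q" by fastforce
  then show "int (mdeg m) = q - 1" by (simp add: mdeg_add)
qed

text \<open>Each operator \<open>Var i * pdiff i\<close> multiplies a monomial by its exponent of
  \<open>i\<close>, and these exponents add up to the degree.\<close>

lemma Euler_identity:
  assumes "p \<in> graded q"
  shows "(\<Sum>i\<in>UNIV. Var i * pdiff i p) = Const (of_int q) * p"
proof (rule poly_mapping_eqI)
  fix m
  have "Poly_Mapping.lookup (Var i * pdiff i p) m = of_nat (Poly_Mapping.lookup m i) * Poly_Mapping.lookup p m" for i
  proof (cases "Poly_Mapping.lookup m i = 0")
    case False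
    then have "m - Poly_Mapping.single i 1 + Poly_Mapping.single i 1 = m"
      by (auto simp: poly_mapping_eq_iff fun_eq_iff lookup_add lookup_minus lookup_single_if)
    then show ?thesis using False
      by (simp add: lookup_Var_mult lookup_pdiff lookup_minus del: of_nat_Suc)
  qed (simp add: lookup_Var_mult)
  then have "Poly_Mapping.lookup (\<Sum>i\<in>UNIV. Var i * pdiff i p) m = of_nat (mdeg m) * Poly_Mapping.lookup p m"
    by (simp add: lookup_sum mdeg_def sum_distrib_right)
  also have "\<dots> = of_int q * Poly_Mapping.lookup p m"
    using assms by (auto simp: graded_iff)
  finally show "Poly_Mapping.lookup (\<Sum>i\<in>UNIV. Var i * pdiff i p) m =
    Poly_Mapping.lookup (Const (of_int q) * p) m" by simp
qed

text \<open>In an integral domain the product of the components of top degree is nonzero. All other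
  terms of \<open>p * q\<close> have smaller degree, so a monomial of degree
  \<open>top p + top q\<close> survives.\<close>

lemma exists_key_mult:
  fixes p q :: S4
  assumes "p \<noteq> 0" "q \<noteq> 0"
  shows "\<exists>k\<in>Poly_Mapping.keys (p * q). \<forall>m\<in>Poly_Mapping.keys p. mdeg m \<le> mdeg k"
proof -
  \<comment> \<open>For \<open>r = 0\<close> this maximum is unspecified, but the bounds on the keys
    of \<open>r\<close> below are then vacuous.\<close>
  define top where "top r = Max (mdeg ` Poly_Mapping.keys r)" for r :: S4
  have top: "\<forall>m\<in>Poly_Mapping.keys r. mdeg m \<le> top r" for r
    by (simp add: top_def)
  have nz: "hcomp (top r) r \<noteq> 0" if "r \<noteq> 0" for r
  proof -
    have "top r \<in> mdeg ` Poly_Mapping.keys r" unfolding top_def using that by (intro Max_in) auto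
    then obtain m where "m \<in> Poly_Mapping.keys r" "mdeg m = top r" by auto
    then have "Poly_Mapping.lookup (hcomp (top r) r) m \<noteq> 0" by (simp add: lookup_hcomp in_keys_iff)
    then show ?thesis by auto
  qed
  let ?p = "hcomp (top p) p" and ?q = "hcomp (top q) q"
  have low: "mdeg m < top r" if "m \<in> Poly_Mapping.keys (r - hcomp (top r) r)" for m r
  proof -
    have "Poly_Mapping.lookup r m \<noteq> 0" "mdeg m \<noteq> top r"
      using that by (auto simp: in_keys_iff lookup_minus lookup_hcomp split: if_splits)
    then show ?thesis using top[of r] by (metis in_keys_iff le_neq_implies_less)
  qed
  have le: "mdeg m \<le> top r" if "m \<in> Poly_Mapping.keys (hcomp (top r) r)" for m r
    using that by (auto simp: in_keys_iff lookup_hcomp split: if_splits)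
  have eq: "p * q = ?p * ?q + ((p - ?p) * q + ?p * (q - ?q))" by (simp add: algebra_simps)
  have "?p * ?q \<noteq> 0" using nz assms by simp
  then obtain k where k: "Poly_Mapping.lookup (?p * ?q) k \<noteq> 0"
    by (auto simp: poly_mapping_eq_iff fun_eq_iff)
  have "?p * ?q \<in> graded (int (top p) + int (top q))" by (intro graded_mult) simp_all
  then have dk: "mdeg k = top p + top q" using k unfolding graded_iff by fastforce
  have "mdeg m < top p + top q" if m: "m \<in> Poly_Mapping.keys ((p - ?p) * q)" for m
  proof -
    obtain a b where "a \<in> Poly_Mapping.keys (p - ?p)" "b \<in> Poly_Mapping.keys q" "m = a + b"
      using keys_mult[of "p - ?p" q] m by blast
    then show ?thesis using low[of a p] top[of q] by (auto simp: mdeg_add intro: add_less_le_mono)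
  qed
  then have 1: "Poly_Mapping.lookup ((p - ?p) * q) k = 0" using dk in_keys_iff by fastforce
  have "mdeg m < top p + top q" if m: "m \<in> Poly_Mapping.keys (?p * (q - ?q))" for m
  proof -
    obtain a b where "a \<in> Poly_Mapping.keys ?p" "b \<in> Poly_Mapping.keys (q - ?q)" "m = a + b"
      using keys_mult[of ?p "q - ?q"] m by blast
    then show ?thesis using low[of b q] le[of a p] by (auto simp: mdeg_add intro: add_le_less_mono)
  qed
  then have 2: "Poly_Mapping.lookup (?p * (q - ?q)) k = 0" using dk in_keys_iff by fastforce
  have "Poly_Mapping.lookup (p * q) k \<noteq> 0" using k 1 2 by (subst eq) (simp add: lookup_add)
  then show ?thesis using top[of p] dk by (intro bexI[of _ k]) (auto simp: in_keys_iff)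
qed

text \<open>A nonzero multiple of \<open>p\<close> has a monomial of degree at least that of
  \<open>p\<close>, whereas differentiation lowers degrees.\<close>

lemma dvd_pdiff_imp_zero:
  assumes "p dvd pdiff i p"
  shows "pdiff i p = 0"
proof (rule ccontr)
  assume nz: "pdiff i p \<noteq> 0"
  then obtain c where c: "pdiff i p = p * c" using assms by (elim dvdE)
  then have "p \<noteq> 0" "c \<noteq> 0" using nz by auto
  then obtain k where k: "k \<in> Poly_Mapping.keys (pdiff i p)" "\<forall>m\<in>Poly_Mapping.keys p. mdeg m \<le> mdeg k"
    using exists_key_mult[of p c] c by auto
  then have "k + Poly_Mapping.single i 1 \<in> Poly_Mapping.keys p"
    by (auto simp: in_keys_iff lookup_pdiff)
  then show False using k(2) by (force simp: mdeg_add)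
qed

text \<open>Characteristic zero enters here: the factor produced by differentiating a monomial that
  involves the variable is nonzero.\<close>

lemma pdiff_eq_0_iff: "pdiff i p = 0 \<longleftrightarrow> (\<forall>m\<in>Poly_Mapping.keys p. Poly_Mapping.lookup m i = 0)"
proof
  assume z: "pdiff i p = 0"
  show "\<forall>m\<in>Poly_Mapping.keys p. Poly_Mapping.lookup m i = 0"
  proof (intro ballI, rule ccontr)
    fix m assume m: "m \<in> Poly_Mapping.keys p" "Poly_Mapping.lookup m i \<noteq> 0"
    then have "m - Poly_Mapping.single i 1 + Poly_Mapping.single i 1 = m"
      by (auto simp: poly_mapping_eq_iff fun_eq_iff lookup_add lookup_minus lookup_single_if)
    then have "Poly_Mapping.lookup (pdiff i p) (m - Poly_Mapping.single i 1) \<noteq> 0"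
      using m by (simp add: lookup_pdiff in_keys_iff del: of_nat_Suc)
    then show False using z by simp
  qed
next
  assume *: "\<forall>m\<in>Poly_Mapping.keys p. Poly_Mapping.lookup m i = 0"
  have "Poly_Mapping.lookup p (m + Poly_Mapping.single i 1) = 0" for m
    using *[rule_format, of "m + Poly_Mapping.single i 1"] by (auto simp: in_keys_iff lookup_add)
  then show "pdiff i p = 0" by (intro poly_mapping_eqI) (simp add: lookup_pdiff)
qed

lemma pdiff_all_zero_imp_Const:
  assumes "\<And>i. pdiff i p = 0"
  shows "\<exists>c. p = Const c"
proof -
  have "int (mdeg m) = 0" if "Poly_Mapping.lookup p m \<noteq> 0" for m
    using that assms unfolding pdiff_eq_0_iff by (simp add: mdeg_def in_keys_iff)
  then have "p \<in> graded 0" unfolding graded_iff by blast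
  then show ?thesis by (simp add: graded_zero_iff)
qed

section \<open>Unique factorization\<close>

locale comm_ring_hom =
  fixes h :: "'a::comm_ring_1 \<Rightarrow> 'b::comm_ring_1"
  assumes hom_add: "h (a + b) = h a + h b"
    and hom_mult: "h (a * b) = h a * h b"
    and hom_one: "h 1 = 1"
begin

lemma hom_zero [simp]: "h 0 = 0"
  using hom_add[of 0 0] by simp

lemma hom_dvd: "a dvd b \<Longrightarrow> h a dvd h b"
  by (auto simp: dvd_def hom_mult)

lemma range_add: "a \<in> range h \<Longrightarrow> b \<in> range h \<Longrightarrow> a + b \<in> range h"
  by (elim rangeE) (simp add: hom_add[symmetric])

lemma range_mult: "a \<in> range h \<Longrightarrow> b \<in> range h \<Longrightarrow> a * b \<in> range h"
  by (elim rangeE) (simp add: hom_mult[symmetric])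

lemma range_one: "1 \<in> range h"
  using hom_one by (metis rangeI)

text \<open>The extension of \<open>h\<close> to \<open>'a poly\<close> that sends the indeterminate
  to \<open>x\<close>, written as a Horner scheme.\<close>

definition ext :: "'b \<Rightarrow> 'a poly \<Rightarrow> 'b" where
  "ext x p = fold_coeffs (\<lambda>a b. h a + x * b) p 0"

lemma ext_0 [simp]: "ext x 0 = 0"
  by (simp add: ext_def)

lemma ext_pCons [simp]: "ext x (pCons a p) = h a + x * ext x p"
  by (cases "p = 0 \<and> a = 0") (auto simp: ext_def)

lemma ext_add: "ext x (p + q) = ext x p + ext x q"
  by (induction p q rule: poly_induct2) (simp_all add: hom_add algebra_simps)

lemma ext_smult: "ext x (smult a p) = h a * ext x p"
  by (induction p) (simp_all add: hom_mult algebra_simps)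

lemma ext_mult: "ext x (p * q) = ext x p * ext x q"
  by (induction p) (simp_all add: ext_add ext_smult algebra_simps)

lemma comm_ring_hom_ext: "comm_ring_hom (ext x)"
  by unfold_locales (simp_all add: ext_add ext_mult one_pCons hom_one)

end

definition free_of :: "4 \<Rightarrow> S4 \<Rightarrow> bool" where
  "free_of i p \<longleftrightarrow> (\<forall>m. Poly_Mapping.lookup p m \<noteq> 0 \<longrightarrow> Poly_Mapping.lookup m i = 0)"

text \<open>An embedding whose image does not involve the variable \<open>i\<close>. Such an
  embedding stays injective when the variable is adjoined, so the construction can be
  iterated.\<close>

locale poly_hom = comm_ring_hom h for h :: "'a::comm_ring_1 \<Rightarrow> S4" +
  fixes i :: 4
  assumes inj: "h a = 0 \<Longrightarrow> a = 0" and free: "free_of i (h a)"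
begin

text \<open>The images under \<open>h\<close> do not involve the variable \<open>i\<close>, so the
  exponent of \<open>i\<close> in \<open>m\<close> alone decides which coefficient of
  \<open>p\<close> contributes.\<close>

lemma lookup_ext:
  "Poly_Mapping.lookup (ext (Var i) p) m =
    Poly_Mapping.lookup (h (coeff p (Poly_Mapping.lookup m i))) (m - Poly_Mapping.single i (Poly_Mapping.lookup m i))"
proof (induction p arbitrary: m)
  case (pCons a p)
  show ?case
  proof (cases "Poly_Mapping.lookup m i")
    case 0
    then show ?thesis by (simp add: lookup_add lookup_Var_mult)
  next
    case (Suc k)
    then have "Poly_Mapping.lookup (h a) m = 0" using free[of a] unfolding free_of_def by fastforce
    moreover have "m - Poly_Mapping.single i 1 - Poly_Mapping.single i k = m - Poly_Mapping.single i (Suc k)"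
      by (rule poly_mapping_eqI) (simp add: lookup_minus lookup_single_if)
    ultimately show ?thesis using Suc pCons.IH[of "m - Poly_Mapping.single i 1"]
      by (simp add: lookup_add lookup_Var_mult lookup_minus)
  qed
qed simp

lemma free_of_ext:
  assumes "j \<noteq> i" "\<And>a. free_of j (h a)"
  shows "free_of j (ext (Var i) p)"
  unfolding free_of_def lookup_ext
proof (intro allI impI)
  fix m
  assume "Poly_Mapping.lookup (h (coeff p (Poly_Mapping.lookup m i))) (m - Poly_Mapping.single i (Poly_Mapping.lookup m i)) \<noteq> 0"
  then have "Poly_Mapping.lookup (m - Poly_Mapping.single i (Poly_Mapping.lookup m i)) j = 0"
    using assms(2) unfolding free_of_def by blast
  then show "Poly_Mapping.lookup m j = 0" using assms(1) by (simp add: lookup_minus lookup_single_if)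
qed

text \<open>Every \<open>h (coeff p n)\<close> can be read off from the image by looking at
  monomials with exponent \<open>n\<close> at \<open>i\<close>; then \<open>h\<close> is
  injective.\<close>

lemma ext_eq_0: 
  assumes "ext (Var i) p = 0"
  shows "p = 0"
proof (rule poly_eqI)
  fix n
  have lk: "Poly_Mapping.lookup (h (coeff p n)) m = 0" for m
  proof (cases "Poly_Mapping.lookup m i = 0")
    case True
    then have "Poly_Mapping.lookup (ext (Var i) p) (m + Poly_Mapping.single i n) = Poly_Mapping.lookup (h (coeff p n)) m"
      unfolding lookup_ext by (simp add: lookup_add)
    then show ?thesis using assms by simp
  next
    case False
    then show ?thesis using free[of "coeff p n", unfolded free_of_def, rule_format, of m] by metis
  qed
  have "h (coeff p n) = 0"
    by (rule poly_mapping_eqI) (simp only: lk lookup_zero)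
  then show "coeff p n = coeff 0 n" by (simp only: inj coeff_0)
qed

lemma range_ext: "range h \<subseteq> range (ext (Var i))" "Var i \<in> range (ext (Var i))"
proof -
  have "h a = ext (Var i) [:a:]" for a by simp
  then show "range h \<subseteq> range (ext (Var i))" by blast
  have "Var i = ext (Var i) [:0, 1:]" by (simp add: hom_one)
  then show "Var i \<in> range (ext (Var i))" by blast
qed

end

lemma single_eq_Const_Var:
  "Poly_Mapping.single m c = Const c * (\<Prod>i\<in>UNIV. Var i ^ Poly_Mapping.lookup m i)"
proof -
  have pw: "Var i ^ k = Poly_Mapping.single (Poly_Mapping.single i k) 1" for i k
    by (induction k) (simp_all add: Var_def mult_single single_add[symmetric])
  have "(\<Prod>i\<in>A. Var i ^ Poly_Mapping.lookup m i) =
      Poly_Mapping.single (\<Sum>i\<in>A. Poly_Mapping.single i (Poly_Mapping.lookup m i)) 1" for A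
    by (induction A rule: infinite_finite_induct) (simp_all add: pw mult_single)
  moreover have "(\<Sum>i\<in>UNIV. Poly_Mapping.single i (Poly_Mapping.lookup m i)) = m"
    by (rule poly_mapping_eqI) (simp add: lookup_sum lookup_single_if)
  ultimately show ?thesis by (simp add: Const_def mult_single)
qed

text \<open>The isomorphism with an iterated univariate polynomial ring makes Gauss's lemma available.\<close>

lemma iterated_poly_isomorphism:
  obtains \<Psi> :: "complex poly poly poly poly \<Rightarrow> S4" where "comm_ring_hom \<Psi>" "bij \<Psi>"
proof -
  have fC: "free_of i (Const c)" for i c
    by (auto simp: free_of_def lookup_Const split: if_splits)
  interpret h0: comm_ring_hom Const
    by unfold_locales (simp_all add: Const_add Const_mult)
  \<comment> \<open>The variables are adjoined in the order 4, 3, 2, 1. The facts \<open>f4\<close>,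
    \<open>f3\<close>, \<open>f2\<close> record that the variables still to come do not occur in the
    image reached so far.\<close>
  interpret h4: poly_hom Const 4
    by unfold_locales (use fC Const_eq_iff[of _ 0] in auto)
  let ?E4 = "h0.ext (Var 4)"
  interpret h4': comm_ring_hom ?E4 by (rule h0.comm_ring_hom_ext)
  have f4: "free_of i (?E4 a)" if "i \<noteq> 4" for i a
    using h4.free_of_ext[OF that fC] .
  interpret h3: poly_hom ?E4 3
    by unfold_locales (use h4.ext_eq_0 f4 in auto)
  let ?E3 = "h4'.ext (Var 3)"
  interpret h3': comm_ring_hom ?E3 by (rule h4'.comm_ring_hom_ext)
  have f3: "free_of i (?E3 a)" if "i \<noteq> 4" "i \<noteq> 3" for i a
    using h3.free_of_ext[OF that(2) f4] that by blast
  interpret h2: poly_hom ?E3 2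
    by unfold_locales (use h3.ext_eq_0 f3 in auto)
  let ?E2 = "h3'.ext (Var 2)"
  interpret h2': comm_ring_hom ?E2 by (rule h3'.comm_ring_hom_ext)
  have f2: "free_of i (?E2 a)" if "i \<noteq> 4" "i \<noteq> 3" "i \<noteq> 2" for i a
    using h2.free_of_ext[OF that(3) f3] that by blast
  interpret h1: poly_hom ?E2 1
    by unfold_locales (use h2.ext_eq_0 f2 in auto)
  let ?E1 = "h2'.ext (Var 1)"
  interpret h1': comm_ring_hom ?E1 by (rule h2'.comm_ring_hom_ext)
  have inj: "inj ?E1"
  proof (rule injI)
    fix a b assume "?E1 a = ?E1 b"
    moreover have "?E1 (a - b) + ?E1 b = ?E1 a" by (simp add: h1'.hom_add[symmetric])
    ultimately show "a = b" using h1.ext_eq_0[of "a - b"] by simp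
  qed
  \<comment> \<open>Surjectivity: the range is closed under sums and products and contains all
    constants and variables, hence all monomials.\<close>
  have r3: "range ?E3 \<subseteq> range ?E1"
    by (rule subset_trans[OF h2.range_ext(1) h1.range_ext(1)])
  have r4: "range ?E4 \<subseteq> range ?E1"
    by (rule subset_trans[OF h3.range_ext(1) r3])
  have rC: "range Const \<subseteq> range ?E1"
    by (rule subset_trans[OF h4.range_ext(1) r4])
  have rV: "Var i \<in> range ?E1" for i
    using exhaust_4[of i] h1.range_ext(2) subsetD[OF h1.range_ext(1) h2.range_ext(2)]
      subsetD[OF r3 h3.range_ext(2)] subsetD[OF r4 h4.range_ext(2)] by metis
  have power: "a ^ n \<in> range ?E1" if "a \<in> range ?E1" for a n
    by (induction n) (simp_all add: that h1'.range_one h1'.range_mult)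
  have prod: "finite A \<Longrightarrow> (\<Prod>i\<in>A. Var i ^ g i) \<in> range ?E1" for A g
    by (induction A rule: finite_induct) (simp_all add: rV h1'.range_one h1'.range_mult power)
  have "p \<in> range ?E1" for p
  proof (induction p rule: poly_mapping_single_induct)
    case (single m c)
    have "Const c \<in> range ?E1" by (rule subsetD[OF rC]) (rule rangeI)
    then show ?case unfolding single_eq_Const_Var by (intro h1'.range_mult prod) simp_all
  qed (rule h1'.range_add)
  then have "range ?E1 = UNIV" by (intro set_eqI) (simp only: UNIV_I)
  then have "bij ?E1" using inj unfolding bij_def by simp
  then show ?thesis by (rule that[OF h1'.comm_ring_hom_axioms])
qed

text \<open>The iterated polynomial ring is factorial; its prime divisors are transported along the
  isomorphism, which preserves and reflects divisibility.\<close>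

lemma S4_prime_divisor_exists:
  fixes x :: S4
  assumes "x \<noteq> 0" "\<not> x dvd 1"
  obtains p where "prime_elem p" "p dvd x"
proof -
  obtain \<Psi> :: "complex poly poly poly poly \<Rightarrow> S4" where \<Psi>: "comm_ring_hom \<Psi>" "bij \<Psi>"
    by (rule iterated_poly_isomorphism)
  interpret comm_ring_hom \<Psi> by fact
  have surj: "\<exists>a. s = \<Psi> a" for s using \<Psi>(2) by (metis bij_pointE)
  have inj: "\<Psi> a = \<Psi> b \<longleftrightarrow> a = b" for a b using \<Psi>(2) by (simp add: bij_def inj_eq)
  have dvd: "\<Psi> a dvd \<Psi> b \<longleftrightarrow> a dvd b" for a b
    using hom_dvd surj by (auto simp: dvd_def) (metis hom_mult inj)
  obtain y where y: "x = \<Psi> y" using surj by blast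
  have "y \<noteq> 0" using assms(1) y by auto
  moreover have "\<not> is_unit y" using assms(2) dvd[of y 1] y hom_one by simp
  ultimately obtain q where q: "q dvd y" "prime q"
    using prime_divisor_exists by blast
  have "prime_elem (\<Psi> q)"
    unfolding prime_elem_def
  proof (intro conjI allI impI)
    show "\<Psi> q \<noteq> 0" using q inj[of q 0] by auto
    show "\<not> \<Psi> q dvd 1" using q dvd[of q 1] hom_one by auto
    fix a b assume *: "\<Psi> q dvd a * b"
    obtain a' b' where "a = \<Psi> a'" "b = \<Psi> b'" using surj by blast
    then show "\<Psi> q dvd a \<or> \<Psi> q dvd b"
      using * q(2) by (simp add: hom_mult[symmetric] dvd prime_dvd_mult_iff)
  qed
  then show ?thesis using that q dvd y by blast
qed

text \<open>On the iterated side, \<open>F\<close> divides the gcd of all \<open>K * G i\<close>,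
  which is \<open>K\<close> times the gcd of the \<open>G i\<close> up to a unit, and the latter gcd
  is itself a unit.\<close>

lemma S4_dvd_of_dvd_mult_coprime:
  fixes f H :: S4 and g :: "4 \<Rightarrow> S4"
  assumes "\<And>u. (\<And>i. u dvd g i) \<Longrightarrow> u dvd 1" "\<And>i. f dvd H * g i"
  shows "f dvd H"
proof -
  obtain \<Psi> :: "complex poly poly poly poly \<Rightarrow> S4" where \<Psi>: "comm_ring_hom \<Psi>" "bij \<Psi>"
    by (rule iterated_poly_isomorphism)
  interpret comm_ring_hom \<Psi> by fact
  have surj: "\<exists>a. s = \<Psi> a" for s using \<Psi>(2) by (metis bij_pointE)
  have inj: "\<Psi> a = \<Psi> b \<longleftrightarrow> a = b" for a b using \<Psi>(2) by (simp add: bij_def inj_eq)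
  have dvd: "\<Psi> a dvd \<Psi> b \<longleftrightarrow> a dvd b" for a b
    using hom_dvd surj by (auto simp: dvd_def) (metis hom_mult inj)
  obtain F K where FK: "f = \<Psi> F" "H = \<Psi> K" using surj by blast
  have "\<forall>i. \<exists>a. g i = \<Psi> a" using surj by blast
  then obtain G where G: "\<And>i. g i = \<Psi> (G i)" by metis
  have "is_unit (Gcd (range G))"
  proof -
    have "\<Psi> (Gcd (range G)) dvd g i" for i
      unfolding G dvd by (rule Gcd_dvd) (rule rangeI)
    then have "\<Psi> (Gcd (range G)) dvd \<Psi> 1" using assms(1) hom_one by simp
    then show ?thesis by (simp only: dvd)
  qed
  moreover have "F dvd Gcd ((*) K ` range G)"
    using assms(2) by (intro Gcd_greatest) (auto simp: FK G hom_mult[symmetric] dvd)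
  then have "F dvd K * Gcd (range G)" unfolding Gcd_mult by simp
  ultimately have "F dvd K" using dvd_mult_unit_iff by blast
  then show ?thesis by (simp add: FK dvd)
qed

section \<open>The gradient of a squarefree form\<close>

text \<open>By Euler's identity \<open>u\<close> divides \<open>f\<close>. If \<open>u\<close> had a
  prime divisor \<open>p\<close>, write \<open>f = p * q\<close>; squarefreeness gives that
  \<open>p\<close> does not divide \<open>q\<close>. The product rule then makes \<open>p\<close>
  divide every \<open>pdiff i p\<close>, so these vanish for reasons of degree and \<open>p\<close>
  is a constant.\<close>

lemma common_divisor_gradient_unit:
  assumes f: "reduced_surface d f" and u: "\<And>i. u dvd pdiff i f"
  shows "u dvd 1"
proof (rule ccontr)
  assume nu: "\<not> u dvd 1"
  have d: "d \<ge> 1" and fd: "f \<in> graded d" and sq: "squarefree f"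
    using f by (auto simp: reduced_surface_def)
  \<comment> \<open>Euler's identity can be solved for \<open>f\<close> because
    \<open>d \<ge> 1\<close>.\<close>
  have eq: "Const (1 / of_int d) * (\<Sum>i\<in>UNIV. Var i * pdiff i f) = f"
    using d by (simp add: Euler_identity[OF fd] mult.assoc[symmetric] Const_mult[symmetric])
  have uf: "u dvd f"
    by (subst eq[symmetric]) (intro dvd_mult dvd_sum u)
  have "u \<noteq> 0" using uf sq by auto
  then obtain p where p: "prime_elem p" "p dvd u"
    using S4_prime_divisor_exists nu by blast
  then obtain q where q: "f = p * q" using uf by (meson dvdE dvd_trans)
  have "\<not> p dvd q"
  proof
    assume "p dvd q"
    then have "p ^ 2 dvd f" unfolding q power2_eq_square by (rule mult_dvd_mono[OF dvd_refl])
    then show False using sq p by (auto dest: squarefreeD prime_elem_not_unit)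
  qed
  moreover have "p dvd pdiff i p * q" for i
  proof -
    have "p dvd pdiff i p * q + p * pdiff i q"
      using u[of i] p(2) unfolding q pdiff_mult by (rule dvd_trans[rotated])
    then show ?thesis using dvd_add_left_iff dvd_triv_left by blast
  qed
  ultimately have "pdiff i p = 0" for i
    using p(1) dvd_pdiff_imp_zero prime_elem_dvd_mult_iff by blast
  then obtain c where c: "p = Const c" using pdiff_all_zero_imp_Const by blast
  then have "c \<noteq> 0" using p(1) by auto
  then have "p * Const (1 / c) = 1" using c by (simp add: Const_mult[symmetric])
  then show False using p(1) by (metis dvdI prime_elem_not_unit)
qed

text \<open>Contracting the proportionality with the coordinates gives
  \<open>H * pdiff i f = d * f * h i\<close>. As the partial derivatives have no common factor,
  \<open>f\<close> divides \<open>H\<close>, and the quotient divided by \<open>d\<close> is the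
  factor sought.\<close>

lemma proportional_to_gradient:
  assumes f: "reduced_surface d f" and h: "\<And>i j. h i * pdiff j f = h j * pdiff i f"
  shows "\<exists>g. \<forall>i. h i = g * pdiff i f"
proof -
  have d: "d \<ge> 1" and fd: "f \<in> graded d" and "f \<noteq> 0"
    using f by (auto simp: reduced_surface_def)
  define H where "H = (\<Sum>j\<in>UNIV. Var j * h j)"
  have H: "H * pdiff i f = Const (of_int d) * f * h i" for i
  proof -
    have "H * pdiff i f = (\<Sum>j\<in>UNIV. Var j * (h j * pdiff i f))"
      by (simp add: H_def sum_distrib_right mult.assoc)
    also have "\<dots> = (\<Sum>j\<in>UNIV. Var j * pdiff j f) * h i"
      unfolding sum_distrib_right by (rule sum.cong) (simp_all only: h[of _ i] ac_simps)
    finally show ?thesis by (simp add: Euler_identity[OF fd])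
  qed
  have "f dvd H"
  proof (rule S4_dvd_of_dvd_mult_coprime[of "\<lambda>i. pdiff i f"])
    show "u dvd 1" if "\<And>i. u dvd pdiff i f" for u
      by (rule common_divisor_gradient_unit[OF f that])
    show "f dvd H * pdiff i f" for i by (simp add: H)
  qed
  then obtain k where k: "H = f * k" by (elim dvdE)
  have "h i = Const (1 / of_int d) * k * pdiff i f" for i
  proof -
    have "f * (k * pdiff i f) = f * (Const (of_int d) * h i)"
      using H[of i] k by (simp add: ac_simps)
    then have "k * pdiff i f = Const (of_int d) * h i" using \<open>f \<noteq> 0\<close> mult_left_cancel by blast
    then have "Const (1 / of_int d) * k * pdiff i f = Const (1 / of_int d) * Const (of_int d) * h i"
      by (simp only: mult.assoc)
    also have "\<dots> = h i" using d by (simp add: Const_mult[symmetric])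
    finally show ?thesis ..
  qed
  then show ?thesis by blast
qed

lemma gradient_nonzero:
  assumes "reduced_surface d f"
  obtains i where "pdiff i f \<noteq> 0"
proof -
  have "\<not> (\<forall>i. pdiff i f = 0)"
    using common_divisor_gradient_unit[OF assms, of 0] by auto
  then show ?thesis using that by blast
qed

section \<open>Constant syzygies and cones\<close>

lemma pdiff_Const [simp]: "pdiff i (Const c) = 0"
  unfolding Const_def pdiff_single by simp

lemma pdiff_Const_mult: "pdiff i (Const c * p) = Const c * pdiff i p"
  by (simp add: pdiff_mult)

lemma pdiff_Var: "pdiff i (Var j) = (if i = j then 1 else 0)"
  by (auto simp: Var_def pdiff_single lookup_single_if)

lemma pdiff_1 [simp]: "pdiff i 1 = 0"
  using pdiff_Const[of i 1] by simp

lemma pdiff_power: "pdiff i (p ^ n) = of_nat n * p ^ (n - 1) * pdiff i p"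
proof (induction n)
  case (Suc n)
  then show ?case by (cases n) (simp_all add: pdiff_mult algebra_simps)
qed simp

lemma pdiff_prod:
  "finite I \<Longrightarrow> pdiff k (\<Prod>i\<in>I. g i) = (\<Sum>i\<in>I. pdiff k (g i) * (\<Prod>j\<in>I - {i}. g j))"
proof (induction I rule: finite_induct)
  case (insert a I)
  have "(\<Prod>j\<in>insert a I - {i}. g j) = g a * (\<Prod>j\<in>I - {i}. g j)" if "i \<in> I" for i
  proof -
    have "insert a I - {i} = insert a (I - {i})" using insert that by auto
    then show ?thesis using insert by simp
  qed
  moreover have "insert a I - {a} = I" using insert by auto
  ultimately show ?case using insert
    by (simp add: pdiff_mult sum_distrib_left ac_simps)
qed simp

lemma of_nat_eq_Const: "of_nat n = Const (of_nat n)"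
  by (simp add: Const_def)

section \<open>Linear changes of coordinates\<close>

abbreviation lin_form :: "complex^4^4 \<Rightarrow> 4 \<Rightarrow> S4" where
  "lin_form A i \<equiv> \<Sum>j\<in>UNIV. Const (A $ i $ j) * Var j"

text \<open>Two polynomials and their sum can thus be expanded over one common set of monomials,
  even if terms cancel.\<close>

lemma lin_subst_superset:
  assumes "finite K" "Poly_Mapping.keys p \<subseteq> K"
  shows "lin_subst A p =
    (\<Sum>m\<in>K. Const (Poly_Mapping.lookup p m) * (\<Prod>i\<in>UNIV. lin_form A i ^ Poly_Mapping.lookup m i))"
  unfolding lin_subst_def using assms by (intro sum.mono_neutral_left) (auto simp: in_keys_iff)

lemma lin_subst_add: "lin_subst A (p + q) = lin_subst A p + lin_subst A q"
proof -
  let ?K = "Poly_Mapping.keys p \<union> Poly_Mapping.keys q"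
  have K: "finite ?K" by simp
  show ?thesis
    using Poly_Mapping.keys_add[of p q]
    by (simp add: lin_subst_superset[OF K] lookup_add Const_add distrib_right sum.distrib)
qed

lemma lin_subst_Const_mult: "lin_subst A (Const c * p) = Const c * lin_subst A p"
proof -
  have "Poly_Mapping.keys (Const c * p) \<subseteq> Poly_Mapping.keys p" by (auto simp: in_keys_iff)
  then show ?thesis
    unfolding lin_subst_superset[OF finite_keys subset_refl, of A p]
    by (subst lin_subst_superset[of "Poly_Mapping.keys p"])
      (simp_all only: finite_keys lookup_Const_mult Const_mult sum_distrib_left mult.assoc)
qed

lemma lin_subst_0 [simp]: "lin_subst A 0 = 0"
  by (simp add: lin_subst_def)

lemma lin_subst_sum: "lin_subst A (sum g I) = (\<Sum>i\<in>I. lin_subst A (g i))"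
  by (induction I rule: infinite_finite_induct) (simp_all add: lin_subst_add)

lemma lin_subst_single:
  "lin_subst A (Poly_Mapping.single m c) = Const c * (\<Prod>i\<in>UNIV. lin_form A i ^ Poly_Mapping.lookup m i)"
  by (subst lin_subst_superset[of "{m}"]) auto

text \<open>This is the chain rule: the \<open>i\<close>-th linear form has the constant derivative
  \<open>A $ i $ k\<close>.\<close>

lemma pdiff_lin_subst:
  "pdiff k (lin_subst A p) = (\<Sum>i\<in>UNIV. Const (A $ i $ k) * lin_subst A (pdiff i p))"
proof (induction p rule: poly_mapping_single_induct)
  case (single m c)
  let ?L = "lin_form A"
  have L: "pdiff k (?L i) = Const (A $ i $ k)" for i
    by (simp add: pdiff_sum pdiff_Const_mult pdiff_Var if_distrib[of "(*) _"] cong: if_cong)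
  have e: "lin_subst A (pdiff i (Poly_Mapping.single m c)) =
    Const c * (of_nat (Poly_Mapping.lookup m i) * ?L i ^ (Poly_Mapping.lookup m i - 1)
      * (\<Prod>j\<in>UNIV - {i}. ?L j ^ Poly_Mapping.lookup m j))" for i
  proof -
    have "(\<Prod>j\<in>UNIV. ?L j ^ Poly_Mapping.lookup (m - Poly_Mapping.single i 1) j) =
      ?L i ^ Poly_Mapping.lookup (m - Poly_Mapping.single i 1) i *
      (\<Prod>j\<in>UNIV - {i}. ?L j ^ Poly_Mapping.lookup (m - Poly_Mapping.single i 1) j)"
      by (rule prod.remove) simp_all
    also have "\<dots> = ?L i ^ (Poly_Mapping.lookup m i - 1) * (\<Prod>j\<in>UNIV - {i}. ?L j ^ Poly_Mapping.lookup m j)"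
      by (simp add: lookup_minus lookup_single_if)
    finally show ?thesis
      unfolding pdiff_single lin_subst_single of_nat_eq_Const Const_mult by (simp only: ac_simps)
  qed
  have "pdiff k (lin_subst A (Poly_Mapping.single m c)) =
    Const c * (\<Sum>i\<in>UNIV. of_nat (Poly_Mapping.lookup m i) * ?L i ^ (Poly_Mapping.lookup m i - 1) * Const (A $ i $ k) *
      (\<Prod>j\<in>UNIV - {i}. ?L j ^ Poly_Mapping.lookup m j))"
    unfolding lin_subst_single pdiff_Const_mult by (subst pdiff_prod) (simp_all add: pdiff_power L del: mult_cancel_left)
  also have "\<dots> = (\<Sum>i\<in>UNIV. Const (A $ i $ k) * lin_subst A (pdiff i (Poly_Mapping.single m c)))"
    unfolding e sum_distrib_left by (rule sum.cong) (simp_all only: ac_simps)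
  finally show ?case .
next
  case (add p q)
  then show ?case by (simp add: pdiff_add lin_subst_add distrib_left sum.distrib)
qed

lemma exists_invertible_with_column:
  fixes c :: "complex^4"
  assumes "c \<noteq> 0"
  obtains A :: "complex^4^4" where "invertible A" "\<And>i. A $ i $ 4 = c $ i"
proof -
  obtain k where k: "c $ k \<noteq> 0" using assms by (auto simp: vec_eq_iff)
  \<comment> \<open>Start from the identity matrix, put \<open>c\<close> into column 4 and, if
    \<open>k\<close> is not 4, the fourth unit vector into column \<open>k\<close>. Since
    \<open>c $ k\<close> is nonzero, the kernel is trivial.\<close>
  define A :: "complex^4^4" where
    "A = (\<chi> i j. if j = 4 then c $ i else if j = k then (if i = 4 then 1 else 0) else if i = j then 1 else 0)"
  have "x = 0" if x: "A *v x = 0" for x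
  proof -
    have "(\<Sum>j\<in>UNIV. A $ i $ j * x $ j) = 0" for i
      using x by (simp add: matrix_vector_mult_def vec_eq_iff)
    then have *: "A$i$1 * x$1 + A$i$2 * x$2 + A$i$3 * x$3 + A$i$4 * x$4 = 0" for i by (simp add: sum_4)
    show ?thesis
      using *[of 1] *[of 2] *[of 3] *[of 4] k exhaust_4[of k] 
      by (auto simp: A_def vec_eq_iff forall_4)
  qed
  then have "inj ((*v) A)"
    by (metis (no_types, lifting) injI matrix_vector_mult_diff_distrib eq_iff_diff_eq_0)
  then have "invertible A"
    by (simp add: invertible_left_inverse matrix_left_invertible_injective inj_def)
  then show ?thesis using that[of A] by (simp add: A_def)
qed

text \<open>Choose coordinates whose fourth axis has direction \<open>c\<close>. By the chain rule
  the syzygy says that the transformed equation has zero derivative along this axis.\<close>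

lemma cone_of_constant_syzygy:
  fixes c :: "complex^4"
  assumes "c \<noteq> 0" "(\<Sum>i\<in>UNIV. Const (c $ i) * pdiff i f) = 0"
  shows "cone_over_plane_curve f"
proof -
  obtain A :: "complex^4^4" where A: "invertible A" "\<And>i. A $ i $ 4 = c $ i"
    using exists_invertible_with_column[OF assms(1)] by blast
  have "pdiff 4 (lin_subst A f) = lin_subst A (\<Sum>i\<in>UNIV. Const (c $ i) * pdiff i f)"
    by (simp add: pdiff_lin_subst A lin_subst_sum lin_subst_Const_mult)
  then have "pdiff 4 (lin_subst A f) = 0" using assms(2) by simp
  then show ?thesis using A unfolding cone_over_plane_curve_def pdiff_eq_0_iff by blast
qed

section \<open>The triple wedge product of syzygies\<close>

text \<open>The numeral \<open>4\<close> denotes the zero of the index type and is therefore its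
  least element.\<close>

lemma less_index4: "(4::4) < 1" "(4::4) < 2" "(4::4) < 3" "(1::4) < 2" "(1::4) < 3" "(2::4) < 3"
  by (simp_all add: less_bit0_def bit0.Rep_numeral bit0.Rep_1)

lemma omega_nth: "omega \<rho> $ I = (\<Sum>i\<in>UNIV. if I = {i} then \<rho> $ i else 0)"
  by (auto simp: omega_def dcoord_def intro!: sum.cong)

lemma omega_singleton: "omega \<rho> $ {i} = \<rho> $ i"
  by (simp add: omega_nth singleton_insert_inj_eq)

lemma omega_eq_0: "card I \<noteq> 1 \<Longrightarrow> omega \<rho> $ I = 0"
  unfolding omega_nth by (rule sum.neutral) auto

text \<open>A 1-form has coefficients on singletons only, so a wedge product with it reduces to a
  sum over single indices.\<close>

lemma sum_Pow_singletons:
  fixes g :: "'a::finite set \<Rightarrow> 'b::comm_monoid_add"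
  assumes "\<And>I. card I \<noteq> 1 \<Longrightarrow> g I = 0"
  shows "(\<Sum>I\<in>Pow K. g I) = (\<Sum>i\<in>K. g {i})"
proof -
  have "(\<Sum>I\<in>Pow K. g I) = (\<Sum>I\<in>(\<lambda>i. {i}) ` K. g I)"
  proof (intro sum.mono_neutral_right ballI)
    fix I assume I: "I \<in> Pow K - (\<lambda>i. {i}) ` K"
    then have "card I \<noteq> 1" by (auto simp: card_1_singleton_iff)
    then show "g I = 0" by (rule assms)
  qed auto
  also have "\<dots> = (\<Sum>i\<in>K. g {i})" by (subst sum.reindex) simp_all
  finally show ?thesis .
qed

lemma omega_wedge:
  "(omega \<rho> \<and>\<^sub>f \<beta>) $ K = (\<Sum>i\<in>K. wedge_sign {i} (K - {i}) * \<rho> $ i * \<beta> $ (K - {i}))"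
proof -
  have "(omega \<rho> \<and>\<^sub>f \<beta>) $ K = (\<Sum>I\<in>Pow K. wedge_sign I (K - I) * omega \<rho> $ I * \<beta> $ (K - I))"
    by (simp add: wedge_def)
  also have "\<dots> = (\<Sum>i\<in>K. wedge_sign {i} (K - {i}) * omega \<rho> $ {i} * \<beta> $ (K - {i}))"
    by (rule sum_Pow_singletons) (simp add: omega_eq_0)
  finally show ?thesis by (simp add: omega_singleton)
qed

lemma wedge_omega:
  "(\<alpha> \<and>\<^sub>f omega \<rho>) $ K = (\<Sum>i\<in>K. wedge_sign (K - {i}) {i} * \<alpha> $ (K - {i}) * \<rho> $ i)"
proof -
  have "(\<alpha> \<and>\<^sub>f omega \<rho>) $ K = (\<Sum>I\<in>Pow K. wedge_sign I (K - I) * \<alpha> $ I * omega \<rho> $ (K - I))"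
    by (simp add: wedge_def)
  also have "\<dots> = (\<Sum>I\<in>Pow K. wedge_sign (K - I) I * \<alpha> $ (K - I) * omega \<rho> $ I)"
    by (rule sum.reindex_bij_witness[of _ "\<lambda>I. K - I" "\<lambda>I. K - I"]) (auto simp: double_diff)
  also have "\<dots> = (\<Sum>i\<in>K. wedge_sign (K - {i}) {i} * \<alpha> $ (K - {i}) * omega \<rho> $ {i})"
    by (rule sum_Pow_singletons) (simp add: omega_eq_0)
  finally show ?thesis by (simp add: omega_singleton)
qed

lemma wedge_sign_empty: "wedge_sign {} J = 1"
  by (simp add: wedge_sign_def)

lemma wedge_sign_insert:
  assumes "a \<notin> I"
  shows "wedge_sign (insert a I) {k} = (if k < a then - 1 else 1) * wedge_sign I {k}"
proof -
  have "{(i, j). i \<in> insert a I \<and> j \<in> {k} \<and> j < i} =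
      (if k < a then {(a, k)} else {}) \<union> {(i, j). i \<in> I \<and> j \<in> {k} \<and> j < i}"
    by auto
  moreover have "finite {(i, j). i \<in> I \<and> j \<in> {k} \<and> j < i}" by simp
  ultimately show ?thesis using assms by (simp add: wedge_sign_def)
qed

text \<open>The determinant of the columns \<open>i, j, k\<close> of the matrix with rows
  \<open>a, b, c\<close>, expanded along \<open>c\<close>; the other factors are coefficients of the
  wedge product of the first two forms.\<close>

definition minor3 :: "S4^4 \<Rightarrow> S4^4 \<Rightarrow> S4^4 \<Rightarrow> 4 \<Rightarrow> 4 \<Rightarrow> 4 \<Rightarrow> S4" where
  "minor3 a b c i j k =
     (a$i * b$j - a$j * b$i) * c$k - (a$i * b$k - a$k * b$i) * c$j + (a$j * b$k - a$k * b$j) * c$i"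

text \<open>The entry \<open>i\<close> is, up to sign, the coefficient of \<open>v_map a b (omega c)\<close> at the complement of
  \<open>{i}\<close>; the signs make the vector orthogonal to \<open>a, b, c\<close>. The indices of the minors follow the order
  \<open>4 < 1 < 2 < 3\<close> of the index type.\<close>

definition cross4 :: "S4^4 \<Rightarrow> S4^4 \<Rightarrow> S4^4 \<Rightarrow> S4^4" where
  "cross4 a b c = (\<chi> i. if i = 1 then - minor3 a b c 4 2 3 else if i = 2 then minor3 a b c 4 1 3
     else if i = 3 then - minor3 a b c 4 1 2 else minor3 a b c 1 2 3)"

lemma v_map_minor3:
  assumes "i < j" "j < k"
  shows "v_map a b (omega c) $ {i, j, k} = minor3 a b c i j k"
proof -
  have ne: "i \<noteq> j" "j \<noteq> k" "i \<noteq> k" "j \<noteq> i" "k \<noteq> j" "k \<noteq> i" "i < k" "\<not> j < i" "\<not> k < j" "\<not> k < i"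
    using assms by auto
  have two: "(omega a \<and>\<^sub>f omega b) $ {p, q} = a$p * b$q - a$q * b$p" if "p < q" for p q
    using that by (auto simp: omega_wedge insert_Diff_if omega_singleton wedge_sign_insert wedge_sign_empty)
  have d: "{i, j, k} - {i} = {j, k}" "{i, j, k} - {j} = {i, k}" "{i, j, k} - {k} = {i, j}"
    using ne by auto
  show ?thesis
    using ne assms by (simp add: v_map_def wedge_omega[of "omega a \<and>\<^sub>f omega b"] d two wedge_sign_insert wedge_sign_empty minor3_def)
      (simp add: algebra_simps)
qed

text \<open>A product of three 1-forms lives on index sets of size 3. These are the complements of
  points, and there the coefficients are the entries of \<open>cross4\<close> up to sign.\<close>

lemma v_map_eq_0_iff: "v_map a b (omega c) = 0 \<longleftrightarrow> cross4 a b c = 0"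
proof
  assume "v_map a b (omega c) = 0"
  then have "minor3 a b c i j k = 0" if "i < j" "j < k" for i j k
    using v_map_minor3[OF that, of a b c] by simp
  then show "cross4 a b c = 0" by (simp add: cross4_def vec_eq_iff less_index4)
next
  assume z: "cross4 a b c = 0"
  then have "cross4 a b c $ 1 = 0" "cross4 a b c $ 2 = 0" "cross4 a b c $ 3 = 0" "cross4 a b c $ 4 = 0"
    by simp_all
  then have m: "minor3 a b c 4 2 3 = 0" "minor3 a b c 4 1 3 = 0" "minor3 a b c 4 1 2 = 0" "minor3 a b c 1 2 3 = 0"
    by (simp_all add: cross4_def)
  have "v_map a b (omega c) $ K = 0" for K
  proof (cases "card K = 3")
    case False
    have "(omega a \<and>\<^sub>f omega b) $ (K - {k}) = 0" if "k \<in> K" for k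
    proof -
      have "omega b $ (K - {k} - {i}) = 0" if "i \<in> K - {k}" for i
      proof (rule omega_eq_0)
        have "card K = Suc (Suc (card (K - {k} - {i})))"
          using that \<open>k \<in> K\<close> by (metis card.remove finite)
        then show "card (K - {k} - {i}) \<noteq> 1" using False by simp
      qed
      then show ?thesis by (simp add: omega_wedge)
    qed
    then show ?thesis by (simp add: v_map_def wedge_omega)
  next
    case True
    then have "card (- K) = 1" by (simp add: Compl_eq_Diff_UNIV card_Diff_subset)
    then obtain l where l: "- K = {l}" by (rule card_1_singletonE)
    then have K: "K = - {l}" by blast
    have "- {1::4} = {4, 2, 3}" "- {2::4} = {4, 1, 3}" "- {3::4} = {4, 1, 2}" "- {4::4} = {1, 2, 3}"
      using UNIV_4 by (auto simp: set_eq_iff forall_4)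
    then show ?thesis
      using m exhaust_4[of l] unfolding K
      by (elim disjE) (simp_all add: v_map_minor3 less_index4)
  qed
  then show "v_map a b (omega c) = 0" by (simp add: vec_eq_iff)
qed

lemma cross4_add: "cross4 a b (c + c') = cross4 a b c + cross4 a b c'"
  by (simp add: cross4_def minor3_def vec_eq_iff algebra_simps)

lemma cross4_smult: "cross4 a b (x *s c) = x *s cross4 a b c"
  by (simp add: cross4_def minor3_def vec_eq_iff algebra_simps)

lemma cross4_smult_fst: "cross4 (x *s a) b c = x *s cross4 a b c"
  by (simp add: cross4_def minor3_def vec_eq_iff algebra_simps)

lemma cross4_smult_snd: "cross4 a (x *s b) c = x *s cross4 a b c"
  by (simp add: cross4_def minor3_def vec_eq_iff algebra_simps)

lemma cross4_same: "cross4 a a c = 0"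
  by (simp add: cross4_def minor3_def vec_eq_iff algebra_simps)

lemma cross4_graded:
  assumes "\<And>i. a $ i \<in> graded p" "\<And>i. b $ i \<in> graded q" "\<And>i. c $ i \<in> graded r"
  shows "cross4 a b c $ i \<in> graded (p + q + r)"
proof -
  have ab: "a $ i * b $ j \<in> graded (p + q)" for i j using assms by (rule_tac graded_mult)
  have "minor3 a b c i j k \<in> graded (p + q + r)" for i j k
    unfolding minor3_def
    by (intro graded_add graded_diff graded_mult[of _ "p + q" _ r] ab assms)
  then show ?thesis by (simp add: cross4_def graded_uminus)
qed

text \<open>Both vectors are orthogonal to \<open>a, b, c\<close>, and the claim says that their 2x2
  minors vanish.\<close>

lemma cross4_orthogonal:
  assumes "(\<Sum>i\<in>UNIV. a $ i * F i) = 0" "(\<Sum>i\<in>UNIV. b $ i * F i) = 0" "(\<Sum>i\<in>UNIV. c $ i * F i) = 0"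
  shows "cross4 a b c $ i * F j = cross4 a b c $ j * F i"
proof -
  have s: "a $ 1 * F 1 + a $ 2 * F 2 + a $ 3 * F 3 + a $ 4 * F 4 = 0"
    "b $ 1 * F 1 + b $ 2 * F 2 + b $ 3 * F 3 + b $ 4 * F 4 = 0"
    "c $ 1 * F 1 + c $ 2 * F 2 + c $ 3 * F 3 + c $ 4 * F 4 = 0"
    using assms by (simp_all add: sum_4)
  \<comment> \<open>Cramer's rule: in a minor multiplied by some \<open>F i\<close>, column
    \<open>i\<close> is replaced by means of the three relations, and only the missing column
    survives.\<close>
  have "minor3 a b c 1 2 3 * F 1 = - minor3 a b c 4 2 3 * F 4"
    "minor3 a b c 1 2 3 * F 2 = minor3 a b c 4 1 3 * F 4"
    "minor3 a b c 1 2 3 * F 3 = - minor3 a b c 4 1 2 * F 4"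
    "- minor3 a b c 4 2 3 * F 2 = minor3 a b c 4 1 3 * F 1"
    "- minor3 a b c 4 2 3 * F 3 = - minor3 a b c 4 1 2 * F 1"
    "minor3 a b c 4 1 3 * F 3 = - minor3 a b c 4 1 2 * F 2"
    unfolding minor3_def using s by algebra+
  then show ?thesis
    using exhaust_4[of i] exhaust_4[of j] by (elim disjE) (simp_all add: cross4_def)
qed

section \<open>Dimensions of graded pieces\<close>

lemma linear_vector_coordinate: "linear_map vscale cscale (\<lambda>s::S4^'n. s $ i)"
  by unfold_locales simp_all

text \<open>With \<open>q i\<close> of the form \<open>q - e i\<close> this is the degree
  \<open>q\<close> part of a sum of shifted copies of the ring.\<close>

definition vgraded :: "('n \<Rightarrow> int) \<Rightarrow> (S4^'n) set" where
  "vgraded q = {s. \<forall>i. s $ i \<in> graded (q i)}"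

lemma subspace_vgraded: "CV.subspace (vgraded q)"
  by (auto simp: vgraded_def CV.subspace_def graded_add intro: CS.subspace_scale[OF subspace_graded])

text \<open>Induction on the set \<open>I\<close> of coordinates allowed to be nonzero: projection
  to a new coordinate \<open>j\<close> has kernel \<open>U I\<close> and image
  \<open>graded (q j)\<close>.\<close>

lemma findim_dim_vgraded:
  fixes q :: "'n::finite \<Rightarrow> int"
  shows "CV.findim (vgraded q) \<and> int (CV.dim (vgraded q)) = (\<Sum>i\<in>UNIV. binom3 (q i))"
proof -
  define U where "U I = {s::S4^'n. \<forall>i. s $ i \<in> (if i \<in> I then graded (q i) else {0})}" for I
  have "CV.findim (U I) \<and> int (CV.dim (U I)) = (\<Sum>i\<in>I. binom3 (q i))" for I
    using finite[of I]
  proof (induction I rule: finite_induct)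
    case empty
    have "U {} = {0}" by (auto simp: U_def vec_eq_iff)
    moreover have "CV.dim {0 :: S4^'n} = 0"
      using CV.dim_unique[of "{}" "{0 :: S4^'n}" 0] CV.independent_empty by simp
    moreover have "CV.findim {0 :: S4^'n}" using CV.findim_span[of "{}"] by simp
    ultimately show ?case by simp
  next
    case (insert j I)
    let ?T = "\<lambda>s::S4^'n. s $ j"
    have sub: "CV.subspace (U (insert j I))"
      by (auto simp: U_def CV.subspace_def graded_add split: if_splits
          intro: CS.subspace_scale[OF subspace_graded])
    have ker: "{s \<in> U (insert j I). s $ j = 0} = U I"
      using insert(2) by (force simp: U_def split: if_splits)
    have img: "?T ` U (insert j I) = graded (q j)"
    proof
      show "?T ` U (insert j I) \<subseteq> graded (q j)" by (auto simp: U_def)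
      show "graded (q j) \<subseteq> ?T ` U (insert j I)"
      proof
        fix p assume "p \<in> graded (q j)"
        then have "(\<chi> i. if i = j then p else 0) \<in> U (insert j I)" by (auto simp: U_def)
        then show "p \<in> ?T ` U (insert j I)" by (rule rev_image_eqI) simp
      qed
    qed
    have fd: "CV.findim {s \<in> U (insert j I). s $ j = 0}" "CS.findim (?T ` U (insert j I))"
      using insert(3) findim_graded by (simp_all add: ker img)
    have "CV.findim (U (insert j I))"
      by (rule linear_map.findim_rank_nullity[OF linear_vector_coordinate sub fd])
    moreover have "CV.dim (U (insert j I)) = CV.dim (U I) + CS.dim (graded (q j))"
      using linear_map.dim_rank_nullity[OF linear_vector_coordinate sub fd] by (simp only: ker img)
    ultimately show ?case using insert by (simp add: dim_graded)
  qed
  moreover have "U UNIV = vgraded q" by (simp add: U_def vgraded_def)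
  ultimately show ?thesis by metis
qed

lemmas findim_vgraded = findim_dim_vgraded[THEN conjunct1]
  and dim_vgraded = findim_dim_vgraded[THEN conjunct2]

text \<open>A basis of \<open>V\<close> modulo \<open>W\<close> together with a basis
  \<open>C\<close> of \<open>W \<inter> V\<close> is a basis of \<open>V\<close>. Conversely,
  extending \<open>C\<close> to a basis of \<open>V\<close> yields a basis modulo \<open>W\<close>.
  So all such bases have one cardinality, as the definite description in \<open>milnor_dim\<close>
  requires.\<close>

lemma basis_modulo_card_iff:
  assumes V: "CS.subspace V" "CS.findim V" and W: "CS.subspace W"
  shows "(\<exists>B. basis_modulo W V B \<and> card B = n) \<longleftrightarrow> n + CS.dim (W \<inter> V) = CS.dim V"
proof -
  have WV: "CS.subspace (W \<inter> V)" using CS.subspace_inter V W by blast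
  obtain C where C: "C \<subseteq> W \<inter> V" "CS.independent C" "W \<inter> V \<subseteq> CS.span C" "card C = CS.dim (W \<inter> V)"
    using CS.basis_exists[of "W \<inter> V"] .
  have fC: "finite C" using CS.findim_independent_finite[OF V(2) _ C(2)] C(1) by blast
  have spC: "CS.span C = W \<inter> V" using CS.span_subspace[OF C(1) C(3) WV] .
  have only: "card B + CS.dim (W \<inter> V) = CS.dim V" if "basis_modulo W V B" for B
  proof -
    have B: "finite B" "B \<subseteq> V" "\<And>v. v \<in> V \<Longrightarrow> \<exists>c. v - (\<Sum>b\<in>B. Const (c b) * b) \<in> W"
      "\<And>c b. (\<Sum>b\<in>B. Const (c b) * b) \<in> W \<Longrightarrow> b \<in> B \<Longrightarrow> c b = 0"
      using that unfolding basis_modulo_def by blast+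
    have disj: "B \<inter> C = {}"
    proof (rule ccontr)
      assume "B \<inter> C \<noteq> {}"
      then obtain b where b: "b \<in> B" "b \<in> C" by blast
      have "(\<Sum>x\<in>B. Const (if x = b then 1 else 0) * x) = b"
        using b B(1) by (simp add: if_distrib[of Const] if_distrib[of "\<lambda>c. c * _"] cong: if_cong)
      then have "(\<Sum>x\<in>B. Const (if x = b then 1 else 0) * x) \<in> W" using b C(1) by auto
      from B(4)[OF this b(1)] show False by simp
    qed
    have "CS.independent (B \<union> C)"
    proof (rule CS.independent_if_scalars_zero)
      show "finite (B \<union> C)" using B fC by simp
      fix g x assume s: "(\<Sum>x\<in>B \<union> C. Const (g x) * x) = 0" and x: "x \<in> B \<union> C"
      have s2: "(\<Sum>x\<in>B. Const (g x) * x) + (\<Sum>x\<in>C. Const (g x) * x) = 0"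
        using s sum.union_disjoint[OF B(1) fC disj, of "\<lambda>x. Const (g x) * x"] by simp
      have "(\<Sum>x\<in>C. Const (g x) * x) \<in> W"
        using C(1) by (intro CS.subspace_sum[OF W] CS.subspace_scale[OF W]) auto
      then have "- (\<Sum>x\<in>C. Const (g x) * x) \<in> W" by (rule CS.subspace_neg[OF W])
      moreover have "(\<Sum>x\<in>B. Const (g x) * x) = - (\<Sum>x\<in>C. Const (g x) * x)"
        using s2 by (rule eq_neg_iff_add_eq_0[THEN iffD2])
      ultimately have "(\<Sum>x\<in>B. Const (g x) * x) \<in> W" by simp
      then have gB: "g b = 0" if "b \<in> B" for b using B(4) that by blast
      then have "(\<Sum>x\<in>C. Const (g x) * x) = 0" using s2 by simp
      then have "g c = 0" if "c \<in> C" for c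
        using CS.independentD[OF C(2) fC subset_refl] that by blast
      then show "g x = 0" using gB x by blast
    qed
    moreover have "V \<subseteq> CS.span (B \<union> C)"
    proof
      fix v assume v: "v \<in> V"
      obtain c where c: "v - (\<Sum>b\<in>B. Const (c b) * b) \<in> W" using B(3)[OF v] by blast
      have "(\<Sum>b\<in>B. Const (c b) * b) \<in> V"
        using B(2) by (intro CS.subspace_sum[OF V(1)] CS.subspace_scale[OF V(1)]) auto
      then have "v - (\<Sum>b\<in>B. Const (c b) * b) \<in> V" using CS.subspace_diff[OF V(1) v] by blast
      then have "v - (\<Sum>b\<in>B. Const (c b) * b) \<in> CS.span C" using c spC by blast
      then have 1: "v - (\<Sum>b\<in>B. Const (c b) * b) \<in> CS.span (B \<union> C)"
        using CS.span_mono[of C "B \<union> C"] by blast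
      have "(\<Sum>b\<in>B. Const (c b) * b) \<in> CS.span (B \<union> C)"
        by (intro CS.span_sum CS.span_scale CS.span_base) simp
      then show "v \<in> CS.span (B \<union> C)" using CS.span_add[OF 1] by fastforce
    qed
    ultimately have "card (B \<union> C) = CS.dim V"
      using CS.basis_card_eq_dim[of "B \<union> C" V] B(2) C(1) by blast
    then show ?thesis using C(4) B(1) fC disj by (simp add: card_Un_disjoint)
  qed
  obtain D where D: "C \<subseteq> D" "D \<subseteq> V" "CS.independent D" "V \<subseteq> CS.span D"
    using CS.maximal_independent_subset_extend[of C V] C by blast
  have fD: "finite D" using CS.findim_independent_finite[OF V(2) D(2,3)] .
  let ?B = "D - C"
  have "basis_modulo W V ?B"
    unfolding basis_modulo_def
  proof (intro conjI ballI allI impI)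
    show "finite ?B" "?B \<subseteq> V" using fD D by auto
    fix v assume "v \<in> V"
    then have "v \<in> CS.span D" using D by blast
    then obtain c where c: "v = (\<Sum>b\<in>D. Const (c b) * b)" unfolding CS.span_finite[OF fD] by blast
    have "v - (\<Sum>b\<in>?B. Const (c b) * b) = (\<Sum>b\<in>C. Const (c b) * b)"
      using sum.subset_diff[OF D(1) fD, of "\<lambda>b. Const (c b) * b"] c by simp
    also have "\<dots> \<in> W"
      using C(1) by (intro CS.subspace_sum[OF W] CS.subspace_scale[OF W]) auto
    finally show "\<exists>c. v - (\<Sum>b\<in>?B. Const (c b) * b) \<in> W" by blast
  next
    fix c b assume w: "(\<Sum>b\<in>?B. Const (c b) * b) \<in> W" and b: "b \<in> ?B"
    have "(\<Sum>b\<in>?B. Const (c b) * b) \<in> V"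
      using D(2) by (intro CS.subspace_sum[OF V(1)] CS.subspace_scale[OF V(1)]) auto
    then have 1: "(\<Sum>b\<in>?B. Const (c b) * b) \<in> CS.span C" using w spC by blast
    have 2: "(\<Sum>b\<in>?B. Const (c b) * b) \<in> CS.span ?B"
      by (intro CS.span_sum CS.span_scale CS.span_base) simp
    have "(\<Sum>b\<in>?B. Const (c b) * b) = 0"
      by (rule CS.span_Int_disjoint[OF D(3) D(1) _ _ 1 2]) auto
    then show "c b = 0"
      using CS.independentD[OF D(3) _ _ _ b] fD by blast
  qed
  moreover from this have "card ?B + CS.dim (W \<inter> V) = CS.dim V" by (rule only)
  ultimately show ?thesis using only by (metis add_right_cancel)
qed

section \<open>Graded pieces of the Milnor algebra\<close>

lemma jacobian_ideal_eq: "jacobian_ideal f = range (\<lambda>a. \<Sum>i\<in>UNIV. a $ i * pdiff i f)"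
proof -
  interpret S: module "(*) :: S4 \<Rightarrow> S4 \<Rightarrow> S4" by unfold_locales (simp_all add: algebra_simps)
  let ?G = "\<lambda>a::S4^4. \<Sum>i\<in>UNIV. a $ i * pdiff i f"
  have "S.span (range (\<lambda>i. pdiff i f)) = range ?G"
  proof
    have "S.subspace (range ?G)"
    proof (rule S.subspaceI)
      have "0 = ?G 0" by simp
      then show "0 \<in> range ?G" by blast
      fix x y c assume "x \<in> range ?G"
      then obtain a where a: "x = ?G a" by blast
      have "c * x = ?G (c *s a)" 
        unfolding a sum_distrib_left by (rule sum.cong) (simp_all only: vector_smult_component mult.assoc)
      then show "c * x \<in> range ?G" by blast
      assume "y \<in> range ?G"
      then obtain b where b: "y = ?G b" by blast
      have "x + y = ?G (a + b)" by (simp add: a b distrib_right sum.distrib)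
      then show "x + y \<in> range ?G" by blast
    qed
    moreover have "pdiff i f = ?G (axis i 1)" for i
      by (simp add: axis_def if_distrib[of "\<lambda>c. c * _"] cong: if_cong)
    then have "range (\<lambda>i. pdiff i f) \<subseteq> range ?G" by blast
    ultimately show "S.span (range (\<lambda>i. pdiff i f)) \<subseteq> range ?G" by (intro S.span_minimal)
    show "range ?G \<subseteq> S.span (range (\<lambda>i. pdiff i f))"
    proof (rule image_subsetI)
      fix a :: "S4^4"
      show "?G a \<in> S.span (range (\<lambda>i. pdiff i f))"
        by (intro S.span_sum S.span_scale S.span_base rangeI)
    qed
  qed
  then show ?thesis by (simp add: jacobian_ideal_def)
qed

lemma AR_graded_eq: "AR_graded f q = {a \<in> vgraded (\<lambda>_. q). (\<Sum>i\<in>UNIV. a $ i * pdiff i f) = 0}"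
  by (auto simp: AR_graded_def AR_def vgraded_def)

lemma linear_gradient_pairing:
  "linear_map vscale cscale (\<lambda>a. \<Sum>i\<in>UNIV. a $ i * pdiff i f)"
  by unfold_locales (simp_all add: distrib_right sum.distrib sum_distrib_left mult.assoc)

lemma findim_AR_graded: "CV.findim (AR_graded f q)"
  by (rule CV.findim_subset[OF findim_vgraded[of "\<lambda>_. q"]]) (auto simp: AR_graded_eq)

lemma subspace_AR_graded: "CV.subspace (AR_graded f q)"
  using CV.subspace_inter[OF subspace_vgraded[of "\<lambda>_. q"]
      module_hom.subspace_kernel[OF linear_gradient_pairing[unfolded linear_map_def linear_iff_module_hom], of f]]
  by (simp add: AR_graded_eq Collect_conj_eq)

text \<open>In the rank-nullity formula for the pairing with the gradient, the kernel is the graded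
  piece of \<open>AR f\<close> and the image is the degree \<open>k\<close> part of the Jacobian
  ideal.\<close>

lemma milnor_dim_eq:
  assumes f: "f \<in> graded d"
  shows "int (milnor_dim f k) = binom3 k - 4 * binom3 (k - d + 1) + int (CV.dim (AR_graded f (k - d + 1)))"
proof -
  let ?q = "k - d + 1" and ?J = "jacobian_ideal f"
  let ?G = "\<lambda>a::S4^4. \<Sum>i\<in>UNIV. a $ i * pdiff i f" and ?U = "vgraded (\<lambda>_::4. k - d + 1)"
  have fi: "pdiff i f \<in> graded (d - 1)" for i using pdiff_graded[OF f] .
  have q': "k - (d - 1) = ?q" by simp
  have img: "?G ` ?U = ?J \<inter> graded k"
  proof
    show "?G ` ?U \<subseteq> ?J \<inter> graded k"
    proof
      fix p assume "p \<in> ?G ` ?U"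
      then obtain a where a: "a \<in> ?U" "p = ?G a" by blast
      have "a $ i * pdiff i f \<in> graded k" for i
        using graded_mult[OF _ fi, of "a $ i" ?q i] a(1) by (simp add: vgraded_def)
      then show "p \<in> ?J \<inter> graded k" using a by (auto simp: jacobian_ideal_eq intro: graded_sum)
    qed
    show "?J \<inter> graded k \<subseteq> ?G ` ?U"
    proof
      fix p assume p: "p \<in> ?J \<inter> graded k"
      then obtain a where a: "p = ?G a" by (auto simp: jacobian_ideal_eq)
      \<comment> \<open>As \<open>p\<close> has degree \<open>k\<close> and the partial derivatives
        have degree \<open>d - 1\<close>, only these components of the coefficients contribute to
        \<open>p\<close>.\<close>
      define b :: "S4^4" where "b = (\<chi> i. hcomp ?q (a $ i))"
      have "p = hcomp k p" using p hcomp_of_graded[of p k k] by simp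
      also have "\<dots> = ?G b"
        unfolding a hcomp_sum b_def hcomp_mult[OF fi] q' vec_lambda_beta ..
      finally show "p \<in> ?G ` ?U" by (rule image_eqI) (simp add: b_def vgraded_def)
    qed
  qed
  have "CV.findim {a \<in> ?U. ?G a = 0}"
    using findim_AR_graded[of f ?q] by (simp add: AR_graded_eq)
  moreover have "CS.findim (?G ` ?U)"
    unfolding img by (rule CS.findim_subset[OF findim_graded[of k]]) blast
  ultimately have "CV.dim ?U = CV.dim {a \<in> ?U. ?G a = 0} + CS.dim (?G ` ?U)"
    by (rule linear_map.dim_rank_nullity[OF linear_gradient_pairing subspace_vgraded])
  then have "CV.dim ?U = CV.dim (AR_graded f ?q) + CS.dim (?J \<inter> graded k)"
    by (simp only: img AR_graded_eq)
  then have 1: "4 * binom3 ?q = int (CV.dim (AR_graded f ?q)) + int (CS.dim (?J \<inter> graded k))"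
    using dim_vgraded[of "\<lambda>_::4. ?q"] by simp
  have "CS.subspace ?J"
    using linear_gradient_pairing[unfolded linear_map_def linear_iff_module_hom, THEN module_hom.subspace_image, OF CV.subspace_UNIV]
    by (simp add: jacobian_ideal_eq)
  note iff = basis_modulo_card_iff[OF subspace_graded findim_graded this]
  have "CS.dim (?J \<inter> graded k) \<le> CS.dim (graded k)"
    by (rule CS.findim_dim_mono[OF findim_graded]) blast
  \<comment> \<open>The inequality just shown keeps the subtraction of naturals from
    truncating.\<close>
  moreover from this have "milnor_dim f k = CS.dim (graded k) - CS.dim (?J \<inter> graded k)"
    unfolding milnor_dim_def iff by (intro the_equality) simp_all
  ultimately have "int (milnor_dim f k) + int (CS.dim (?J \<inter> graded k)) = binom3 k"
    using dim_graded[of k] by linarith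
  then show ?thesis using 1 by linarith
qed

section \<open>Syzygies of tame surfaces\<close>

lemma AR_add: "a \<in> AR f \<Longrightarrow> b \<in> AR f \<Longrightarrow> a + b \<in> AR f"
  by (simp add: AR_def distrib_right sum.distrib)

lemma AR_smult: "a \<in> AR f \<Longrightarrow> c *s a \<in> AR f"
  by (simp add: AR_def mult.assoc sum_distrib_left[symmetric])

lemma AR_diff: "a \<in> AR f \<Longrightarrow> b \<in> AR f \<Longrightarrow> a - b \<in> AR f"
  by (simp add: AR_def left_diff_distrib sum_subtractf)

lemma AR_gradedD: "a \<in> AR_graded f q \<Longrightarrow> a \<in> AR f" "a \<in> AR_graded f q \<Longrightarrow> a $ i \<in> graded q"
  by (auto simp: AR_graded_def)

lemma smult_AR_graded: "c \<in> graded (q - e) \<Longrightarrow> a \<in> AR_graded f e \<Longrightarrow> c *s a \<in> AR_graded f q"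
  using graded_mult[of c "q - e" _ e] by (auto simp: AR_graded_def AR_smult)

lemma add_AR_graded: "a \<in> AR_graded f q \<Longrightarrow> b \<in> AR_graded f q \<Longrightarrow> a + b \<in> AR_graded f q"
  by (auto simp: AR_graded_def AR_add graded_add)

lemma omega_add: "omega (a + b) = omega a + omega b"
  by (simp add: omega_def vec_eq_iff distrib_right sum.distrib)

lemma omega_smult: "omega (c *s a) = c *s omega a"
  by (simp add: omega_def vec_eq_iff sum_distrib_left mult.assoc)

lemma omega_inject: "omega a = omega b \<longleftrightarrow> a = b"
  by (metis omega_singleton vec_eq_iff)

definition grad :: "S4 \<Rightarrow> S4^4" where
  "grad f = (\<chi> i. pdiff i f)"

text \<open>The Koszul syzygies show that \<open>AR f\<close> is not contained in a module of rank one.\<close>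

lemma AR_not_rank_one:
  assumes f: "reduced_surface d f" and AR: "\<And>\<rho>. \<rho> \<in> AR f \<Longrightarrow> \<exists>t. a *s \<rho> = t *s \<sigma>"
  shows "a = 0"
proof -
  obtain i where i: "pdiff i f \<noteq> 0" using gradient_nonzero[OF f] .
  obtain j k :: 4 where jk: "j \<noteq> i" "k \<noteq> i" "j \<noteq> k"
  proof -
    have "\<exists>j k::4. j \<noteq> i \<and> k \<noteq> i \<and> j \<noteq> k"
      using exhaust_4[of i] by (elim disjE; intro exI[of _ "i + 1"] exI[of _ "i + 2"]) simp_all
    then show ?thesis using that by blast
  qed
  \<comment> \<open>The Koszul syzygy of the pair \<open>i, l\<close>.\<close>
  define K :: "4 \<Rightarrow> S4^4" where
    "K l = (\<chi> m. if m = i then pdiff l f else if m = l then - pdiff i f else 0)" for l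
  have K: "K l \<in> AR f" if "l \<noteq> i" for l
  proof -
    have "K l $ m * pdiff m f = (if m = i then pdiff l f * pdiff i f else 0) + (if m = l then - pdiff i f * pdiff l f else 0)" for m
      using that by (auto simp: K_def)
    then show ?thesis by (simp add: AR_def sum.distrib)
  qed
  obtain t where t: "a *s K j = t *s \<sigma>" using AR[OF K[OF jk(1)]] by blast
  obtain u where u: "a *s K k = u *s \<sigma>" using AR[OF K[OF jk(2)]] by blast
  \<comment> \<open>If \<open>a\<close> were nonzero, the outer equations would make
    \<open>t\<close>, \<open>u\<close> and both entries of \<open>\<sigma>\<close> nonzero, against
    the two equations with right-hand side 0.\<close>
  have "- a * pdiff i f = t * \<sigma> $ j" "t * \<sigma> $ k = 0" "u * \<sigma> $ j = 0" "- a * pdiff i f = u * \<sigma> $ k"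
    using arg_cong[OF t, of "\<lambda>v. v $ j"] arg_cong[OF t, of "\<lambda>v. v $ k"]
      arg_cong[OF u, of "\<lambda>v. v $ j"] arg_cong[OF u, of "\<lambda>v. v $ k"] jk by (auto simp: K_def)
  then show "a = 0" using i by auto
qed

text \<open>A locale, because the results are applied to \<open>f\<close> and also to any other
  surface with the same degrees.\<close>

locale tame_surface =
  fixes f :: S4 and d e1 e2 e3 :: int and \<rho>1 \<rho>2 :: "S4^4"
  assumes red: "reduced_surface d f" and tame: "tame f e1 \<rho>1 e2 \<rho>2" and e3: "e3 = d - 1 - e1 - e2"
begin

lemma fd: "f \<in> graded d"
  using red by (auto simp: reduced_surface_def)

lemma \<rho>1: "\<rho>1 \<in> AR_graded f e1" and \<rho>1_nz: "\<rho>1 \<noteq> 0" and \<rho>2: "\<rho>2 \<in> AR_graded f e2"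
  using tame by (auto simp: tame_def first_syzygy_def second_syzygy_def)

text \<open>Tameness in coordinates: the kernel of \<open>v_map\<close> is the image of
  \<open>u_map\<close>, and \<open>omega\<close> is injective.\<close>

lemma cross4_eq_0_iff:
  assumes "\<rho> \<in> AR f"
  shows "cross4 \<rho>1 \<rho>2 \<rho> = 0 \<longleftrightarrow> (\<exists>a b. \<rho> = a *s \<rho>1 + b *s \<rho>2)"
proof -
  have "cross4 \<rho>1 \<rho>2 \<rho> = 0 \<longleftrightarrow> omega \<rho> \<in> {\<eta> \<in> Omega10 f. v_map \<rho>1 \<rho>2 \<eta> = 0}"
    using assms by (simp add: v_map_eq_0_iff Omega10_def)
  also have "\<dots> \<longleftrightarrow> omega \<rho> \<in> range (u_map \<rho>1 \<rho>2)"
    using tame by (simp add: tame_def)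
  also have "\<dots> \<longleftrightarrow> (\<exists>a b. omega \<rho> = omega (a *s \<rho>1 + b *s \<rho>2))"
    by (auto simp: u_map_def omega_add omega_smult image_iff)
  finally show ?thesis by (simp add: omega_inject)
qed

lemma cross4_span: "cross4 \<rho>1 \<rho>2 (a *s \<rho>1 + b *s \<rho>2) = 0"
  using cross4_eq_0_iff AR_add AR_smult AR_gradedD(1)[OF \<rho>1] AR_gradedD(1)[OF \<rho>2] by blast

lemma cross4_eq_grad:
  assumes "\<rho> \<in> AR f"
  obtains g where "cross4 \<rho>1 \<rho>2 \<rho> = g *s grad f"
proof -
  have "\<exists>g. \<forall>i. cross4 \<rho>1 \<rho>2 \<rho> $ i = g * pdiff i f"
    using AR_gradedD(1)[OF \<rho>1] AR_gradedD(1)[OF \<rho>2] assms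
    by (intro proportional_to_gradient[OF red] cross4_orthogonal) (simp_all add: AR_def)
  then show ?thesis using that by (auto simp: vec_eq_iff grad_def)
qed

lemma grad_nonzero: "grad f \<noteq> 0"
proof -
  obtain i where "pdiff i f \<noteq> 0" using gradient_nonzero[OF red] .
  then show ?thesis by (auto simp: vec_eq_iff grad_def)
qed

text \<open>A nontrivial relation makes \<open>cross4 \<rho>1 \<rho>2\<close> vanish identically, so
  by tameness the two syzygies generate \<open>AR f\<close>. Multiplied by \<open>a\<close> or by
  \<open>b\<close>, every syzygy becomes a multiple of a single one, and
  \<open>AR_not_rank_one\<close> forces both coefficients to be 0.\<close>

lemma independent:
  assumes "a *s \<rho>1 + b *s \<rho>2 = 0"
  shows "a = 0 \<and> b = 0"
proof (rule ccontr)
  assume nz: "\<not> (a = 0 \<and> b = 0)"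
  have neg: "a *s \<rho>1 = (- b) *s \<rho>2" "b *s \<rho>2 = (- a) *s \<rho>1"
    using assms by (simp_all add: vec_eq_iff eq_neg_iff_add_eq_0 add.commute)
  have z: "cross4 \<rho>1 \<rho>2 c = 0" for c
  proof -
    have "a *s cross4 \<rho>1 \<rho>2 c = 0"
      using cross4_smult_fst[of a \<rho>1 \<rho>2 c] unfolding neg(1) cross4_smult_fst by (simp add: cross4_same)
    moreover have "b *s cross4 \<rho>1 \<rho>2 c = 0"
      using cross4_smult_snd[of \<rho>1 b \<rho>2 c] unfolding neg(2) cross4_smult_snd by (simp add: cross4_same)
    ultimately show ?thesis using nz by (auto simp: vec_eq_iff)
  qed
  have "a = 0"
  proof (rule AR_not_rank_one[OF red])
    fix \<rho> assume "\<rho> \<in> AR f"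
    then obtain x y where xy: "\<rho> = x *s \<rho>1 + y *s \<rho>2" using cross4_eq_0_iff z by blast
    have "a *s \<rho> = x *s (a *s \<rho>1) + (y * a) *s \<rho>2"
      by (simp add: xy vec_eq_iff algebra_simps)
    also have "\<dots> = (y * a - x * b) *s \<rho>2"
      unfolding neg by (simp add: vec_eq_iff algebra_simps)
    finally show "\<exists>t. a *s \<rho> = t *s \<rho>2" by blast
  qed
  moreover have "b = 0"
  proof (rule AR_not_rank_one[OF red])
    fix \<rho> assume "\<rho> \<in> AR f"
    then obtain x y where xy: "\<rho> = x *s \<rho>1 + y *s \<rho>2" using cross4_eq_0_iff z by blast
    have "b *s \<rho> = (x * b) *s \<rho>1 + y *s (b *s \<rho>2)"
      by (simp add: xy vec_eq_iff algebra_simps)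
    also have "\<dots> = (x * b - y * a) *s \<rho>1"
      unfolding neg by (simp add: vec_eq_iff algebra_simps)
    finally show "\<exists>t. b *s \<rho> = t *s \<rho>1" by blast
  qed
  ultimately show False using nz by simp
qed

text \<open>Passing to homogeneous components of the right degrees does not change the combination,
  so by independence it does not change the coefficients.\<close>

lemma span_graded:
  assumes "a *s \<rho>1 + b *s \<rho>2 \<in> AR_graded f q"
  shows "a \<in> graded (q - e1) \<and> b \<in> graded (q - e2)"
proof -
  have "(hcomp (q - e1) a - a) *s \<rho>1 + (hcomp (q - e2) b - b) *s \<rho>2 = 0"
  proof -
    have "hcomp (q - e1) a * \<rho>1 $ i + hcomp (q - e2) b * \<rho>2 $ i = a * \<rho>1 $ i + b * \<rho>2 $ i" for i
      using AR_gradedD(2)[OF assms, of i] hcomp_of_graded[of "a * \<rho>1 $ i + b * \<rho>2 $ i" q q]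
        hcomp_mult[OF AR_gradedD(2)[OF \<rho>1], of q a i] hcomp_mult[OF AR_gradedD(2)[OF \<rho>2], of q b i]
      by (simp add: hcomp_add)
    then show ?thesis by (simp add: vec_eq_iff algebra_simps)
  qed
  from independent[OF this] have "hcomp (q - e1) a = a" "hcomp (q - e2) b = b" by simp_all
  then show ?thesis using hcomp_graded by metis
qed

text \<open>The entries of the cross product have degree \<open>e1 + e2 + q\<close>, those of the
  gradient \<open>d - 1\<close>; the difference is \<open>q - e3\<close> by the choice of
  \<open>e3\<close>.\<close>

lemma cross4_graded_eq_grad:
  assumes "\<rho> \<in> AR_graded f q"
  obtains g where "g \<in> graded (q - e3)" "cross4 \<rho>1 \<rho>2 \<rho> = g *s grad f"
proof -
  obtain g where g: "cross4 \<rho>1 \<rho>2 \<rho> = g *s grad f"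
    using cross4_eq_grad[OF AR_gradedD(1)[OF assms]] .
  obtain i where i: "pdiff i f \<noteq> 0" using gradient_nonzero[OF red] .
  have "cross4 \<rho>1 \<rho>2 \<rho> $ i \<in> graded (e1 + e2 + q)"
    using AR_gradedD(2) \<rho>1 \<rho>2 assms by (intro cross4_graded)
  then have "g * pdiff i f \<in> graded ((q - e3) + (d - 1))"
    by (simp add: g grad_def e3 algebra_simps)
  then have "g \<in> graded (q - e3)"
    using graded_mult_cancel[OF _ pdiff_graded[OF fd] i] by blast
  then show ?thesis using that g by blast
qed

section \<open>Dimensions of the graded pieces of \<open>AR f\<close>\<close>

lemma linear_cross4: "linear_map vscale vscale (cross4 \<rho>1 \<rho>2)"
  by unfold_locales (simp_all add: cross4_add cross4_smult)

lemma linear_smult_grad: "linear_map cscale vscale (\<lambda>g. g *s grad f)"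
  by unfold_locales (simp_all add: vec_eq_iff algebra_simps)

lemma linear_combination2:
  "linear_map vscale vscale (\<lambda>s::S4^2. s $ 1 *s \<rho>1 + s $ 2 *s \<rho>2)"
  by unfold_locales (simp_all add: vec_eq_iff algebra_simps)

lemma findim_grad_multiples: "CV.findim ((\<lambda>g. g *s grad f) ` graded p)"
  and dim_grad_multiples: "int (CV.dim ((\<lambda>g. g *s grad f) ` graded p)) = binom3 p"
proof -
  show "CV.findim ((\<lambda>g. g *s grad f) ` graded p)"
    by (rule linear_map.findim_image[OF linear_smult_grad findim_graded])
  show "int (CV.dim ((\<lambda>g. g *s grad f) ` graded p)) = binom3 p"
    using linear_map.dim_injective_image[OF linear_smult_grad subspace_graded findim_graded]
    by (simp add: grad_nonzero dim_graded)
qed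

lemma cross4_image_subset: "cross4 \<rho>1 \<rho>2 ` AR_graded f q \<subseteq> (\<lambda>g. g *s grad f) ` graded (q - e3)"
  using cross4_graded_eq_grad by blast

text \<open>Rank-nullity for \<open>cross4 \<rho>1 \<rho>2\<close>: by tameness and independence its
  kernel is the direct sum of the multiples of \<open>\<rho>1\<close> and of
  \<open>\<rho>2\<close>.\<close>

lemma dim_AR_graded:
  "int (CV.dim (AR_graded f q)) =
    binom3 (q - e1) + binom3 (q - e2) + int (CV.dim (cross4 \<rho>1 \<rho>2 ` AR_graded f q))"
proof -
  let ?\<phi> = "\<lambda>s::S4^2. s $ 1 *s \<rho>1 + s $ 2 *s \<rho>2"
  let ?e = "\<lambda>i::2. if i = 1 then q - e1 else q - e2"
  have ker: "{\<rho> \<in> AR_graded f q. cross4 \<rho>1 \<rho>2 \<rho> = 0} = ?\<phi> ` vgraded ?e"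
  proof
    show "?\<phi> ` vgraded ?e \<subseteq> {\<rho> \<in> AR_graded f q. cross4 \<rho>1 \<rho>2 \<rho> = 0}"
      using \<rho>1 \<rho>2 by (auto simp: vgraded_def forall_2 cross4_span intro!: add_AR_graded intro: smult_AR_graded)
    show "{\<rho> \<in> AR_graded f q. cross4 \<rho>1 \<rho>2 \<rho> = 0} \<subseteq> ?\<phi> ` vgraded ?e"
    proof
      fix \<rho> assume r: "\<rho> \<in> {\<rho> \<in> AR_graded f q. cross4 \<rho>1 \<rho>2 \<rho> = 0}"
      then obtain a b where ab: "\<rho> = a *s \<rho>1 + b *s \<rho>2"
        using cross4_eq_0_iff AR_gradedD(1) by blast
      then have "a \<in> graded (q - e1)" "b \<in> graded (q - e2)" using span_graded r by auto
      then have "vector [a, b] \<in> vgraded ?e" by (simp add: vgraded_def forall_2)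
      then show "\<rho> \<in> ?\<phi> ` vgraded ?e" by (rule rev_image_eqI) (simp add: ab)
    qed
  qed
  have "s = 0" if "?\<phi> s = 0" for s
    using independent[OF that] by (simp add: vec_eq_iff forall_2)
  then have "CV.dim (?\<phi> ` vgraded ?e) = CV.dim (vgraded ?e)"
    by (intro linear_map.dim_injective_image[OF linear_combination2 subspace_vgraded findim_vgraded])
  then have k: "int (CV.dim {\<rho> \<in> AR_graded f q. cross4 \<rho>1 \<rho>2 \<rho> = 0}) = binom3 (q - e1) + binom3 (q - e2)"
    unfolding ker by (simp add: dim_vgraded sum_2)
  have "CV.findim {\<rho> \<in> AR_graded f q. cross4 \<rho>1 \<rho>2 \<rho> = 0}"
    by (rule CV.findim_subset[OF findim_AR_graded[of f q]]) blast
  moreover have "CV.findim (cross4 \<rho>1 \<rho>2 ` AR_graded f q)"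
    by (rule CV.findim_subset[OF findim_grad_multiples cross4_image_subset])
  ultimately show ?thesis
    using linear_map.dim_rank_nullity[OF linear_cross4 subspace_AR_graded] k by simp
qed

lemma dim_AR_graded_le:
  "int (CV.dim (AR_graded f q)) \<le> binom3 (q - e1) + binom3 (q - e2) + binom3 (q - e3)"
  using dim_AR_graded[of q] dim_grad_multiples[of "q - e3"]
    CV.findim_dim_mono[OF findim_grad_multiples cross4_image_subset, of q] by linarith

text \<open>Here \<open>q - e3\<close> is negative, so the upper bound loses its third summand and
  meets the contribution of the kernel.\<close>

lemma dim_AR_graded_small:
  assumes "q < e3"
  shows "int (CV.dim (AR_graded f q)) = binom3 (q - e1) + binom3 (q - e2)"
  using dim_AR_graded[of q] dim_AR_graded_le[of q] assms by (simp add: binom3_def)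

text \<open>Maximal dimension forces the image of \<open>cross4 \<rho>1 \<rho>2\<close> to contain
  all constant multiples of the gradient, in particular the gradient itself.\<close>

lemma exists_third_generator:
  assumes "int (CV.dim (AR_graded f e3)) = binom3 (e3 - e1) + binom3 (e3 - e2) + binom3 0"
  obtains \<rho>3 where "\<rho>3 \<in> AR_graded f e3" "cross4 \<rho>1 \<rho>2 \<rho>3 = grad f"
proof -
  \<comment> \<open>The degree 0 is written as \<open>e3 - e3\<close> to match
    \<open>cross4_image_subset\<close>.\<close>
  have "CV.dim (cross4 \<rho>1 \<rho>2 ` AR_graded f e3) = CV.dim ((\<lambda>g. g *s grad f) ` graded (e3 - e3))"
    using assms dim_AR_graded[of e3] dim_grad_multiples[of "e3 - e3"] by simp
  moreover have "CV.subspace (cross4 \<rho>1 \<rho>2 ` AR_graded f e3)"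
    using module_hom.subspace_image[OF linear_cross4[unfolded linear_map_def linear_iff_module_hom] subspace_AR_graded] .
  ultimately have eq: "cross4 \<rho>1 \<rho>2 ` AR_graded f e3 = (\<lambda>g. g *s grad f) ` graded (e3 - e3)"
    by (intro CV.findim_dim_eq[OF findim_grad_multiples cross4_image_subset])
  have "1 \<in> graded 0" using graded_Const[of 1] by simp
  then have "grad f \<in> cross4 \<rho>1 \<rho>2 ` AR_graded f e3"
    unfolding eq by (intro image_eqI[of _ _ 1]) simp_all
  then show ?thesis using that by (metis imageE)
qed

text \<open>Exponents of a free surface are required to be positive; a nonzero syzygy of degree 0
  would have constant entries and make the surface a cone.\<close>

lemma e1_pos:
  assumes "\<not> cone_over_plane_curve f"
  shows "e1 > 0"
proof -
  obtain i where i: "\<rho>1 $ i \<noteq> 0" using \<rho>1_nz by (auto simp: vec_eq_iff)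
  have "e1 \<ge> 0" using graded_nonneg[OF AR_gradedD(2)[OF \<rho>1] i] .
  moreover have "e1 \<noteq> 0"
  proof
    assume "e1 = 0"
    then have "\<forall>i. \<exists>c. \<rho>1 $ i = Const c" using AR_gradedD(2)[OF \<rho>1] graded_zero_iff by simp
    then obtain c where c: "\<And>i. \<rho>1 $ i = Const (c i)" by metis
    have "(\<Sum>j\<in>UNIV. Const ((\<chi> i. c i) $ j) * pdiff j f) = 0"
      using AR_gradedD(1)[OF \<rho>1] by (simp add: AR_def c)
    moreover have "c i \<noteq> 0" using i c[of i] by auto
    then have "(\<chi> i. c i) \<noteq> 0" by (auto simp: vec_eq_iff)
    ultimately show False using cone_of_constant_syzygy assms by blast
  qed
  ultimately show ?thesis by simp
qed

text \<open>If \<open>\<rho>\<close> has cross product \<open>g *s grad f\<close>, then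
  \<open>\<rho> - g *s \<rho>3\<close> is in the kernel, so the three syzygies generate. In a
  relation, \<open>cross4\<close> isolates the third coefficient, and \<open>independent\<close>
  handles the other two.\<close>

lemma free_if_dim_maximal:
  assumes "int (CV.dim (AR_graded f e3)) = binom3 (e3 - e1) + binom3 (e3 - e2) + binom3 0"
    and "\<not> cone_over_plane_curve f" "e1 \<le> e2" "e2 \<le> e3"
  shows "free_with_exponents f e1 e2 e3"
proof -
  obtain \<rho>3 where \<rho>3: "\<rho>3 \<in> AR_graded f e3" "cross4 \<rho>1 \<rho>2 \<rho>3 = grad f"
    using exists_third_generator[OF assms(1)] .
  define \<phi> where "\<phi> s = (s $ 1 *s \<rho>1 + s $ 2 *s \<rho>2) + s $ 3 *s \<rho>3" for s :: "S4^3"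
  have cross: "cross4 \<rho>1 \<rho>2 (\<phi> s) = s $ 3 *s grad f" for s
    unfolding \<phi>_def cross4_add[of _ _ "_ + _"] cross4_span cross4_smult \<rho>3(2) by simp
  have mod: "module_hom (*s) (*s) \<phi>"
    by unfold_locales (simp_all add: \<phi>_def vec_eq_iff algebra_simps)
  have "inj \<phi>"
  proof (subst module_hom.inj_iff_eq_0[OF mod], intro allI impI)
    fix s assume s: "\<phi> s = 0"
    have "s $ 3 *s grad f = cross4 \<rho>1 \<rho>2 (0 *s \<rho>1 + 0 *s \<rho>2)" using cross[of s] s by simp
    then have s3: "s $ 3 = 0" using cross4_span[of 0 0] grad_nonzero by simp
    then have "s $ 1 *s \<rho>1 + s $ 2 *s \<rho>2 = 0" using s by (simp add: \<phi>_def)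
    from independent[OF this] show "s = 0" using s3 by (simp add: vec_eq_iff forall_3)
  qed
  moreover have "\<phi> ` UNIV = AR f"
  proof
    show "\<phi> ` UNIV \<subseteq> AR f"
      using \<rho>1 \<rho>2 \<rho>3(1) by (auto simp: \<phi>_def intro!: AR_add AR_smult dest: AR_gradedD(1))
    show "AR f \<subseteq> \<phi> ` UNIV"
    proof
      fix \<rho> assume r: "\<rho> \<in> AR f"
      obtain g where g: "cross4 \<rho>1 \<rho>2 \<rho> = g *s grad f" using cross4_eq_grad[OF r] .
      have "cross4 \<rho>1 \<rho>2 \<rho> = cross4 \<rho>1 \<rho>2 (\<rho> - g *s \<rho>3) + cross4 \<rho>1 \<rho>2 (g *s \<rho>3)"
        by (simp only: cross4_add[symmetric] diff_add_cancel)
      then have "cross4 \<rho>1 \<rho>2 (\<rho> - g *s \<rho>3) = 0" by (simp add: g cross4_smult \<rho>3(2))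
      moreover have "\<rho> - g *s \<rho>3 \<in> AR f"
        using r AR_smult[OF AR_gradedD(1)[OF \<rho>3(1)]] by (rule AR_diff)
      ultimately obtain a b where "\<rho> - g *s \<rho>3 = a *s \<rho>1 + b *s \<rho>2" using cross4_eq_0_iff by blast
      then have "\<rho> = (a *s \<rho>1 + b *s \<rho>2) + g *s \<rho>3" by (simp only: diff_eq_eq)
      then have "\<rho> = \<phi> (vector [a, b, g])" by (simp add: \<phi>_def)
      then show "\<rho> \<in> \<phi> ` UNIV" by blast
    qed
  qed
  ultimately have "bij_betw \<phi> UNIV (AR f)" by (simp add: bij_betw_def)
  moreover have "\<phi> s \<in> AR_graded f q"
    if "s $ 1 \<in> graded (q - e1) \<and> s $ 2 \<in> graded (q - e2) \<and> s $ 3 \<in> graded (q - e3)" for q s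
    using that \<rho>1 \<rho>2 \<rho>3(1) unfolding \<phi>_def by (intro add_AR_graded smult_AR_graded) auto
  ultimately show ?thesis
    unfolding free_with_exponents_def using mod e1_pos[OF assms(2)] assms(3,4) by blast
qed

end

text \<open>The isomorphism is injective and maps graded pieces into graded pieces, which yields a
  lower bound; for tame surfaces it meets the upper bound \<open>dim_AR_graded_le\<close>.\<close>

lemma dim_AR_graded_ge_if_free:
  assumes "free_with_exponents f d1 d2 d3"
  shows "binom3 (q - d1) + binom3 (q - d2) + binom3 (q - d3) \<le> int (CV.dim (AR_graded f q))"
proof -
  obtain \<phi> :: "S4^3 \<Rightarrow> S4^4" where \<phi>: "module_hom (*s) (*s) \<phi>" "bij_betw \<phi> UNIV (AR f)"
    "\<And>q s. s $ 1 \<in> graded (q - d1) \<Longrightarrow> s $ 2 \<in> graded (q - d2) \<Longrightarrow> s $ 3 \<in> graded (q - d3) \<Longrightarrow> \<phi> s \<in> AR_graded f q"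
    using assms unfolding free_with_exponents_def by blast
  let ?e = "\<lambda>i::3. if i = 1 then q - d1 else if i = 2 then q - d2 else q - d3"
  have lin: "linear_map vscale vscale \<phi>"
    by unfold_locales (simp_all add: module_hom.add[OF \<phi>(1)] module_hom.scale[OF \<phi>(1)])
  have "inj \<phi>" using \<phi>(2) by (simp add: bij_betw_def)
  then have "s = 0" if "\<phi> s = 0" for s
    using that module_hom.inj_iff_eq_0[OF \<phi>(1)] by blast
  then have "CV.dim (\<phi> ` vgraded ?e) = CV.dim (vgraded ?e)"
    by (intro linear_map.dim_injective_image[OF lin subspace_vgraded findim_vgraded])
  moreover have "\<phi> ` vgraded ?e \<subseteq> AR_graded f q"
    using \<phi>(3) by (auto simp: vgraded_def forall_3)
  then have "CV.dim (\<phi> ` vgraded ?e) \<le> CV.dim (AR_graded f q)"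
    by (rule CV.findim_dim_mono[OF findim_AR_graded])
  ultimately show ?thesis using dim_vgraded[of ?e] by (simp add: sum_3)
qed

theorem theorem1p2:
  fixes f :: S4 and \<rho>1 \<rho>2 :: "S4^4" and d e1 e2 e3 :: int
  assumes "reduced_surface d f"
    and "\<not> cone_over_plane_curve f"
    and "has_proj_dim (jacobian_ideal f) 1"
    and "tame f e1 \<rho>1 e2 \<rho>2"
    and "e1 \<le> e2"
    and "e3 = d - 1 - e1 - e2"
    and "e3 \<ge> e2"
  shows
    "(\<forall>k < e3 + d - 1.
        int (milnor_dim f k) =
          binom3 k - 4 * binom3 (k - d + 1) + binom3 (k - d - e1 + 1) + binom3 (k - d - e2 + 1)) \<and>
     (\<forall>g \<sigma>1 \<sigma>2.
        reduced_surface d g \<and> \<not> cone_over_plane_curve g \<and> has_proj_dim (jacobian_ideal g) 1 \<and>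
        tame g e1 \<sigma>1 e2 \<sigma>2 \<longrightarrow>
        (\<forall>k < e3 + d - 1. milnor_dim g k = milnor_dim f k)) \<and>
     (let bound = (\<lambda>k. binom3 k - 4 * binom3 (k - d + 1) + binom3 (k - d - e1 + 1)
                        + binom3 (k - d - e2 + 1) + binom3 (k - d - e3 + 1))
      in (\<forall>k \<ge> e3 + d - 1. int (milnor_dim f k) \<le> bound k) \<and>
         ((\<forall>k \<ge> e3 + d - 1. int (milnor_dim f k) = bound k) \<longleftrightarrow>
            int (milnor_dim f (e3 + d - 1)) = bound (e3 + d - 1)) \<and>
         ((\<forall>k \<ge> e3 + d - 1. int (milnor_dim f k) = bound k) \<longleftrightarrow>
            free_with_exponents f e1 e2 e3))"
proof -
  \<comment> \<open>Stated for arbitrary \<open>g\<close>, so that it gives both the formula for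
    \<open>f\<close> and the independence of the surface.\<close>
  have small: "int (milnor_dim g k) =
      binom3 k - 4 * binom3 (k - d + 1) + binom3 (k - d - e1 + 1) + binom3 (k - d - e2 + 1)"
    if "reduced_surface d g" "tame g e1 \<sigma>1 e2 \<sigma>2" "k < e3 + d - 1" for g \<sigma>1 \<sigma>2 k
  proof -
    interpret tame_surface g d e1 e2 e3 \<sigma>1 \<sigma>2 using that assms(6) by unfold_locales
    show ?thesis
      using milnor_dim_eq[OF fd, of k] dim_AR_graded_small[of "k - d + 1"] that(3)
      by (simp add: algebra_simps)
  qed
  interpret tame_surface f d e1 e2 e3 \<rho>1 \<rho>2 using assms by unfold_locales
  define bound where "bound k = binom3 k - 4 * binom3 (k - d + 1) + binom3 (k - d - e1 + 1)
    + binom3 (k - d - e2 + 1) + binom3 (k - d - e3 + 1)" for k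
  \<comment> \<open>The degree of the syzygies that matter in degree \<open>k\<close>; the threshold
    \<open>k = e3 + d - 1\<close> corresponds to \<open>q k = e3\<close>.\<close>
  define q where "q k = k - d + 1" for k
  have bound_iff: "int (milnor_dim f k) = bound k \<longleftrightarrow>
      int (CV.dim (AR_graded f (q k))) = binom3 (q k - e1) + binom3 (q k - e2) + binom3 (q k - e3)" for k
    using milnor_dim_eq[OF fd, of k] by (auto simp: bound_def q_def algebra_simps)
  have le: "int (milnor_dim f k) \<le> bound k" for k
    using milnor_dim_eq[OF fd, of k] dim_AR_graded_le[of "q k"]
    by (simp add: bound_def q_def algebra_simps)
  have free: "free_with_exponents f e1 e2 e3" if "int (milnor_dim f (e3 + d - 1)) = bound (e3 + d - 1)"
  proof (rule free_if_dim_maximal[OF _ assms(2,5,7)])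
    show "int (CV.dim (AR_graded f e3)) = binom3 (e3 - e1) + binom3 (e3 - e2) + binom3 0"
      using that unfolding bound_iff by (simp add: q_def)
  qed
  \<comment> \<open>The lower bound from freeness meets the general upper bound in every
    degree.\<close>
  have all: "int (milnor_dim f k) = bound k" if "free_with_exponents f e1 e2 e3" for k
    unfolding bound_iff using dim_AR_graded_ge_if_free[OF that, of "q k"] dim_AR_graded_le[of "q k"] by linarith
  have "milnor_dim g k = milnor_dim f k"
    if "reduced_surface d g" "tame g e1 \<sigma>1 e2 \<sigma>2" "k < e3 + d - 1" for g \<sigma>1 \<sigma>2 k
    using small[OF that] small[OF assms(1,4) that(3)] by linarith
  \<comment> \<open>The equivalences close up in a cycle: equality in all degrees from the threshold
    on includes the threshold, which gives freeness, which gives equality everywhere.\<close>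
  then show ?thesis
    unfolding Let_def bound_def[symmetric]
    using small[OF assms(1,4)] le free all by blast
qed

end
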